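(* Let $G$ be a finite graph cellularly embedded in a compact, connected, orientable, boundaryless surface $\Sigma$, with dual graph $G^*$ and positive coupling constants $(J_{e^*})_{e^*\in E^*}$. For every polygon configuration $P\in\mathcal P^0(G)$ and every $\epsilon\in H_1(\Sigma;\mathbb Z/2\mathbb Z)$, $$W^\epsilon[\mathrm{Mono}=P]=2^{-1}\,\mathcal C\,\Bigl(\prod_{e\in P}e^{-2J_{e^*}}\Bigr)\Bigl(\prod_{i=1}^{n_P}2\,Z_{\mathrm{LT}}^{\Pi_i(\epsilon)}(G_{\Sigma_i},2J)\Bigr),\qquad \mathcal C=\Bigl(2\prod_{e\in E}e^{J_{e^*}}\Bigr)^2.$$ Moreover, the double Ising partition function can be rewritten as $Z_{\mathrm{d\text{-}Ising}}(J)=\sum_{P\in\mathcal P^0(G)}W[\mathrm{Mono}=P]$, and $\mathbb P_{\mathrm{d\text{-}Ising}}$ induces a probability measure on polygon configurations of $\mathcal P^0(G)$ given by $$\forall P\in\mathcal P^0(G),\qquad \mathbb P_{\mathrm{d\text{-}Ising}}[\mathrm{Mono}=P]=\frac{W[\mathrm{Mono}=P]}{Z_{\mathrm{d\text{-}Ising}}(J)}.$$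
   Context: $G=(V,E)$, $G^*=(V^*,E^* )$, $e\mapsto e^*$ the bijection of edges and dual edges. A polygon configuration of $G$ is a subset of $E$ with even degree at every vertex; $\mathcal P^\epsilon(G)$ is the set of those with class $\epsilon\in H_1(\Sigma;\mathbb Z/2\mathbb Z)$. Double Ising model: it is the probability measure $\mathbb P_{\mathrm{d\text{-}Ising}}$ on $\bigcup_\epsilon\mathcal P^\epsilon(G)\times\mathcal P^\epsilon(G)$ giving to $(P_{\mathrm{red}},P_{\mathrm{blue}})$ probability $\mathcal C\prod_{e\in P_{\mathrm{red}}}e^{-2J_{e^*}}\prod_{e\in P_{\mathrm{blue}}}e^{-2J_{e^*}}/Z_{\mathrm{d\text{-}Ising}}(J)$, with $Z_{\mathrm{d\text{-}Ising}}(J)$ the normalizing partition function, which equals $\sum_\epsilon (Z_{\mathrm{Ising}}^\epsilon(J))^2$, where $Z^\epsilon_{\mathrm{Ising}}(J)$ is the partition function of the Ising model on $G^*$ with signs of the coupling constants changed along (the duals of) a representative of $\epsilon$. $\mathrm{Mono}(P_{\mathrm{red}},P_{\mathrm{blue}})$ is the set of edges belonging to exactly one of $P_{\mathrm{red}},P_{\mathrm{blue}}$. $W^\epsilon[\mathrm{Mono}=P]$ is the sum of $\mathcal C\prod_{e\in P_{\mathrm{red}}}e^{-2J_{e^*}}\prod_{e\in P_{\mathrm{blue}}}e^{-2J_{e^*}}$ over pairs in $\mathcal P^\epsilon(G)\times\mathcal P^\epsilon(G)$ with $\mathrm{Mono}(P_{\mathrm{red}},P_{\mathrm{blue}})=P$,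 and $W[\mathrm{Mono}=P]=\sum_{\epsilon\in H_1(\Sigma;\mathbb Z/2\mathbb Z)}W^\epsilon[\mathrm{Mono}=P]$. Components: $P$ separates $\Sigma$ into $n_P\ge1$ connected components; $\Sigma_i$ ($1\le i\le n_P$) denotes the compact surface with (possibly empty) boundary $\partial\Sigma_i$ obtained by cutting $\Sigma$ along $P$, whose interior is the $i$-th component of $\Sigma\setminus P$. $G_{\Sigma_i}$ has vertex set $V_{\Sigma_i}=V\cap\Sigma_i$ and edge set $E_{\Sigma_i}$ the edges of $G$ contained in $\Sigma_i$ and not on $\partial\Sigma_i$. A polygon configuration of $G_{\Sigma_i}$ is a subset of $E_{\Sigma_i}$ with even degree at each vertex not on $\partial\Sigma_i$; $\mathcal P^{\eta}(G_{\Sigma_i})$ is the set of those with class $\eta\in H_1(\Sigma_i,\partial\Sigma_i;\mathbb Z/2\mathbb Z)$. $\Pi_i:H_1(\Sigma;\mathbb Z/2\mathbb Z)\to H_1(\Sigma_i,\partial\Sigma_i;\mathbb Z/2\mathbb Z)$ sends $\epsilon$ to the class of the restriction to $\Sigma_i$ of any representative of $\epsilon$. Finally $Z_{\mathrm{LT}}^{\eta}(G_{\Sigma_i},2J)=\sum_{Q\in\mathcal P^\eta(G_{\Sigma_i})}\prod_{e\in Q}e^{-4J_{e^*}}$. *)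

theory Defs
  imports "HOL-Probability.Probability" "HOL-Complex_Analysis.Complex_Analysis"
begin

section \<open>Closed orientable surfaces\<close>

definition chart :: "'a topology \<Rightarrow> 'a set \<Rightarrow> ('a \<Rightarrow> complex) \<Rightarrow> bool" where
  "chart X U h \<longleftrightarrow>
     openin X U \<and> open (h ` U) \<and> homeomorphic_map (subtopology X U) (top_of_set (h ` U)) h"

text \<open>A homeomorphism between open subsets of the plane preserves the orientation iff the image of
  every small positively oriented circle winds once, positively, around the image of its centre.\<close>

definition orientation_preserving :: "complex set \<Rightarrow> (complex \<Rightarrow> complex) \<Rightarrow> bool" where
  "orientation_preserving S h \<longleftrightarrow>
     (\<forall>z\<in>S. \<forall>r>0. cball z r \<subseteq> S \<longrightarrow> winding_number (h \<circ> circlepath z r) (h z) = 1)"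

definition oriented_atlas :: "'a topology \<Rightarrow> ('a set \<times> ('a \<Rightarrow> complex)) set \<Rightarrow> bool" where
  "oriented_atlas X \<A> \<longleftrightarrow>
     (\<forall>(U, h)\<in>\<A>. chart X U h) \<and> (\<Union>(U, h)\<in>\<A>. U) = topspace X \<and>
     (\<forall>(U, h)\<in>\<A>. \<forall>(U', h')\<in>\<A>.
        orientation_preserving (h ` (U \<inter> U')) (h' \<circ> inv_into U h))"

definition closed_orientable_surface :: "'a topology \<Rightarrow> bool" where
  "closed_orientable_surface X \<longleftrightarrow>
     topspace X \<noteq> {} \<and> Hausdorff_space X \<and> compact_space X \<and> connected_space X \<and>
     (\<exists>\<A>. oriented_atlas X \<A>)"

section \<open>Cellularly embedded graphs\<close>

text \<open>Loops and multiple edges are allowed, hence edges are abstract names carrying a parametrisation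
  of their embedded image by the unit interval.\<close>

record ('a, 'e) surface_graph =
  surf :: "'a topology"
  verts :: "'a set"
  edges :: "'e set"
  param :: "'e \<Rightarrow> real \<Rightarrow> 'a"

definition closed_edge :: "('a, 'e) surface_graph \<Rightarrow> 'e \<Rightarrow> 'a set" where
  "closed_edge G e = param G e ` {0..1}"

definition open_edge :: "('a, 'e) surface_graph \<Rightarrow> 'e \<Rightarrow> 'a set" where
  "open_edge G e = param G e ` {0<..<1}"

definition support :: "('a, 'e) surface_graph \<Rightarrow> 'e set \<Rightarrow> 'a set" where
  "support G P = (\<Union>e\<in>P. closed_edge G e)"

definition graph_image :: "('a, 'e) surface_graph \<Rightarrow> 'a set" where
  "graph_image G = verts G \<union> support G (edges G)"

text \<open>Near each of its points an embedded graph looks like finitely many radii of a disc: two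
  radii at an interior point of an edge, as many radii as the degree at a vertex. For arcs in a
  surface this costs no generality (Schoenflies theorem).\<close>

definition locally_star :: "('a, 'e) surface_graph \<Rightarrow> 'a \<Rightarrow> bool" where
  "locally_star G x \<longleftrightarrow>
     (\<exists>U h D. openin (surf G) U \<and> x \<in> U \<and>
        homeomorphic_map (subtopology (surf G) U) (top_of_set (ball (0::complex) 1)) h \<and> h x = 0 \<and>
        finite D \<and> D \<subseteq> sphere 0 1 \<and>
        h ` (U \<inter> graph_image G) = insert 0 {of_real t * w | t w. w \<in> D \<and> 0 \<le> t \<and> t < 1})"

definition embedded_graph :: "('a, 'e) surface_graph \<Rightarrow> bool" where
  "embedded_graph G \<longleftrightarrow>
     finite (verts G) \<and> verts G \<subseteq> topspace (surf G) \<and> finite (edges G) \<and>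
     (\<forall>e\<in>edges G. pathin (surf G) (param G e) \<and>
        param G e 0 \<in> verts G \<and> param G e 1 \<in> verts G \<and>
        inj_on (param G e) {0<..<1} \<and> open_edge G e \<inter> verts G = {}) \<and>
     disjoint_family_on (open_edge G) (edges G) \<and>
     (\<forall>x\<in>graph_image G. locally_star G x)"

definition faces :: "('a, 'e) surface_graph \<Rightarrow> 'a set set" where
  "faces G = connected_components_of
               (subtopology (surf G) (topspace (surf G) - graph_image G))"

definition cellularly_embedded :: "('a, 'e) surface_graph \<Rightarrow> bool" where
  "cellularly_embedded G \<longleftrightarrow> embedded_graph G \<and>
     (\<forall>f\<in>faces G. subtopology (surf G) f homeomorphic_space top_of_set (ball (0::complex) 1))"

text \<open>The dual graph has vertex set \<open>faces G\<close>, and the dual \<open>e\<^sup>*\<close> of an edge \<open>e\<close> joins the faces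
  lying on the two sides of \<open>e\<close>; it is a loop iff \<open>dual_ends G e\<close> is a singleton. As \<open>e \<mapsto> e\<^sup>*\<close> is a
  bijection, functions on dual edges, such as the coupling constants, are indexed by \<open>e\<close>.\<close>

definition dual_ends :: "('a, 'e) surface_graph \<Rightarrow> 'e \<Rightarrow> 'a set set" where
  "dual_ends G e = {f \<in> faces G. open_edge G e \<subseteq> surf G closure_of f}"

section \<open>Polygon configurations and homology modulo 2\<close>

definition degree_in :: "('a, 'e) surface_graph \<Rightarrow> 'e set \<Rightarrow> 'a \<Rightarrow> nat" where
  "degree_in G Q v = card {e \<in> Q. param G e 0 = v} + card {e \<in> Q. param G e 1 = v}"

text \<open>Below, \<open>S\<close> is either the whole surface or a connected component of the complement of a polygon
  configuration \<open>P\<close>. In the latter case \<open>S\<close> is the interior of a surface with boundary obtained by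
  cutting along \<open>P\<close>, whose cells not on the boundary are exactly the cells of \<open>G\<close> contained in \<open>S\<close>.
  They span the relative cellular chains modulo the boundary, and chains with coefficients in
  \<open>\<int>/2\<int>\<close> are sets of cells. For the whole surface this is ordinary cellular homology.\<close>

definition verts_in :: "('a, 'e) surface_graph \<Rightarrow> 'a set \<Rightarrow> 'a set" where
  "verts_in G S = verts G \<inter> S"

definition edges_in :: "('a, 'e) surface_graph \<Rightarrow> 'a set \<Rightarrow> 'e set" where
  "edges_in G S = {e \<in> edges G. open_edge G e \<subseteq> S}"

definition faces_in :: "('a, 'e) surface_graph \<Rightarrow> 'a set \<Rightarrow> 'a set set" where
  "faces_in G S = {f \<in> faces G. f \<subseteq> S}"

definition polygons :: "('a, 'e) surface_graph \<Rightarrow> 'a set \<Rightarrow> 'e set set" where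
  "polygons G S = {Q. Q \<subseteq> edges_in G S \<and> (\<forall>v\<in>verts_in G S. even (degree_in G Q v))}"

text \<open>An edge having the same face \<open>f\<close> on both sides occurs twice, that is \<open>0\<close> times modulo 2, in
  the boundary of \<open>f\<close>.\<close>

definition face_boundary :: "('a, 'e) surface_graph \<Rightarrow> 'a set \<Rightarrow> 'e set" where
  "face_boundary G f = {e \<in> edges G. f \<in> dual_ends G e \<and> dual_ends G e \<noteq> {f}}"

definition boundary2 :: "('a, 'e) surface_graph \<Rightarrow> 'a set \<Rightarrow> 'a set set \<Rightarrow> 'e set" where
  "boundary2 G S A = {e \<in> edges_in G S. odd (card {f \<in> A. e \<in> face_boundary G f})}"

definition homologous :: "('a, 'e) surface_graph \<Rightarrow> 'a set \<Rightarrow> ('e set \<times> 'e set) set" where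
  "homologous G S = {(Q, Q'). Q \<in> polygons G S \<and> Q' \<in> polygons G S \<and>
                              (\<exists>A\<subseteq>faces_in G S. sym_diff Q Q' = boundary2 G S A)}"

definition hom_class :: "('a, 'e) surface_graph \<Rightarrow> 'a set \<Rightarrow> 'e set \<Rightarrow> 'e set set" where
  "hom_class G S Q = homologous G S `` {Q}"

definition H1_in :: "('a, 'e) surface_graph \<Rightarrow> 'a set \<Rightarrow> 'e set set set" where
  "H1_in G S = polygons G S // homologous G S"

definition polygons_of_class :: "('a, 'e) surface_graph \<Rightarrow> 'a set \<Rightarrow> 'e set set \<Rightarrow> 'e set set" where
  "polygons_of_class G S \<eta> = {Q \<in> polygons G S. hom_class G S Q = \<eta>}"

abbreviation H1 :: "('a, 'e) surface_graph \<Rightarrow> 'e set set set" where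
  "H1 G \<equiv> H1_in G (topspace (surf G))"

abbreviation polygon_configs :: "('a, 'e) surface_graph \<Rightarrow> 'e set set \<Rightarrow> 'e set set" where
  "polygon_configs G \<epsilon> \<equiv> polygons_of_class G (topspace (surf G)) \<epsilon>"

abbreviation null_class :: "('a, 'e) surface_graph \<Rightarrow> 'e set set" where
  "null_class G \<equiv> hom_class G (topspace (surf G)) {}"

definition regions :: "('a, 'e) surface_graph \<Rightarrow> 'e set \<Rightarrow> 'a set set" where
  "regions G P = connected_components_of
                   (subtopology (surf G) (topspace (surf G) - support G P))"

text \<open>The class of the restriction does not depend on the representative, so that the image below
  is a singleton.\<close>

definition restrict_class :: "('a, 'e) surface_graph \<Rightarrow> 'a set \<Rightarrow> 'e set set \<Rightarrow> 'e set set" where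
  "restrict_class G S \<epsilon> =
     the_elem ((\<lambda>Q. hom_class G S (Q \<inter> edges_in G S)) ` polygon_configs G \<epsilon>)"

section \<open>The Ising and double Ising models\<close>

text \<open>For a loop of the dual graph the product of the spins at its two ends is 1.\<close>

definition spin_product :: "('a, 'e) surface_graph \<Rightarrow> ('a set \<Rightarrow> real) \<Rightarrow> 'e \<Rightarrow> real" where
  "spin_product G \<sigma> e = (if card (dual_ends G e) = 1 then 1 else (\<Prod>f\<in>dual_ends G e. \<sigma> f))"

definition Z_spin :: "('a, 'e) surface_graph \<Rightarrow> ('e \<Rightarrow> real) \<Rightarrow> real" where
  "Z_spin G K = (\<Sum>\<sigma>\<in>faces G \<rightarrow>\<^sub>E {-1, 1}. exp (\<Sum>e\<in>edges G. K e * spin_product G \<sigma> e))"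

definition Z_Ising :: "('a, 'e) surface_graph \<Rightarrow> ('e \<Rightarrow> real) \<Rightarrow> 'e set set \<Rightarrow> real" where
  "Z_Ising G J \<epsilon> = (let R = (SOME R. R \<in> polygon_configs G \<epsilon>)
                    in Z_spin G (\<lambda>e. if e \<in> R then - J e else J e))"

definition Z_dIsing :: "('a, 'e) surface_graph \<Rightarrow> ('e \<Rightarrow> real) \<Rightarrow> real" where
  "Z_dIsing G J = (\<Sum>\<epsilon>\<in>H1 G. (Z_Ising G J \<epsilon>)\<^sup>2)"

definition C_const :: "('a, 'e) surface_graph \<Rightarrow> ('e \<Rightarrow> real) \<Rightarrow> real" where
  "C_const G J = (2 * (\<Prod>e\<in>edges G. exp (J e)))\<^sup>2"

definition weight :: "('a, 'e) surface_graph \<Rightarrow> ('e \<Rightarrow> real) \<Rightarrow> 'e set \<times> 'e set \<Rightarrow> real" where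
  "weight G J = (\<lambda>(Pred, Pblue).
     C_const G J * (\<Prod>e\<in>Pred. exp (- 2 * J e)) * (\<Prod>e\<in>Pblue. exp (- 2 * J e)))"

definition double_configs :: "('a, 'e) surface_graph \<Rightarrow> ('e set \<times> 'e set) set" where
  "double_configs G = (\<Union>\<epsilon>\<in>H1 G. polygon_configs G \<epsilon> \<times> polygon_configs G \<epsilon>)"

definition P_dIsing :: "('a, 'e) surface_graph \<Rightarrow> ('e \<Rightarrow> real) \<Rightarrow> ('e set \<times> 'e set) measure" where
  "P_dIsing G J =
     point_measure (double_configs G) (\<lambda>\<omega>. ennreal (weight G J \<omega> / Z_dIsing G J))"

definition Mono :: "'e set \<times> 'e set \<Rightarrow> 'e set" where
  "Mono = (\<lambda>(Pred, Pblue). sym_diff Pred Pblue)"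

definition W_class ::
    "('a, 'e) surface_graph \<Rightarrow> ('e \<Rightarrow> real) \<Rightarrow> 'e set set \<Rightarrow> 'e set \<Rightarrow> real" where
  "W_class G J \<epsilon> P =
     (\<Sum>\<omega> | \<omega> \<in> polygon_configs G \<epsilon> \<times> polygon_configs G \<epsilon> \<and> Mono \<omega> = P. weight G J \<omega>)"

definition W :: "('a, 'e) surface_graph \<Rightarrow> ('e \<Rightarrow> real) \<Rightarrow> 'e set \<Rightarrow> real" where
  "W G J P = (\<Sum>\<epsilon>\<in>H1 G. W_class G J \<epsilon> P)"

definition Z_LT ::
    "('a, 'e) surface_graph \<Rightarrow> 'a set \<Rightarrow> 'e set set \<Rightarrow> ('e \<Rightarrow> real) \<Rightarrow> real" where
  "Z_LT G S \<eta> K = (\<Sum>Q\<in>polygons_of_class G S \<eta>. \<Prod>e\<in>Q. exp (- 2 * K e))"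

end

theory Submission
  imports Defs
begin

text \<open>For a set \<open>A\<close> of faces let \<open>bd A\<close> be the set of edges whose two
  sides have different status with respect to \<open>A\<close>, one side in \<open>A\<close> and the
  other not. Two facts about \<open>bd\<close> carry the whole argument: \<open>bd A\<close> is always a
  polygon configuration (\<open>boundary_is_polygon\<close>), and if \<open>bd A \<subseteq> P\<close>,
  then every connected component of the complement of \<open>P\<close> has all its faces in
  \<open>A\<close> or none (\<open>region_status\<close>). Both come from one turn around a point of the
  graph. In a chart that shows the graph as finitely many radii of a disc, the face seen at angle
  \<open>t\<close> changes at most when \<open>t\<close> passes a radius. After a full turn its status
  is the initial one, so the status changes an even number of times (\<open>even_jumping_rays\<close>),
  and if no radius changes it, all faces around the point have the same status
  (\<open>sides_agree\<close>). To read these statements on the graph one must know that radii and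
  half-edges correspond: the curves that leave a point along the edges match the radii bijectively
  (\<open>germs_rays\<close>). In particular an inner point of an edge has two radii, so the faces
  adherent to it are the same all along the edge, and an edge has exactly the two sides seen from any of
  its points.

  The rest is counting. A homology class is a coset \<open>{sym_diff Q (bd A) | A \<subseteq>
  faces}\<close>. For each \<open>A\<close> there are \<open>2 ^ n\<close> sets \<open>A'\<close> of
  faces such that \<open>bd A'\<close> agrees with \<open>bd A\<close> off \<open>P\<close>, where
  \<open>n\<close> is the number of regions of \<open>P\<close>: one changes the status of whole regions
  (\<open>card_same_boundary_off\<close>). With \<open>P = {}\<close> each element of the class comes
  from two sets of faces; this is the sign symmetry of the spins, and it gives the low-temperature
  expansion \<open>Z_Ising_low_temperature\<close>, hence the identification of \<open>Z_dIsing\<close>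
  with the total weight of the pairs of configurations.

  For the monochromatic edges, a pair with symmetric difference \<open>P\<close> is \<open>(Q, sym_diff Q
  P)\<close>, and its weight is \<open>C_const\<close> times \<open>\<Prod>e\<in>P. exp (- 2 * J
  e)\<close> times \<open>\<Prod>e\<in>Q - P. exp (- 4 * J e)\<close>. The set \<open>Q - P\<close> is
  the disjoint union of the restrictions of \<open>Q\<close> to the regions. When \<open>Q\<close> runs
  over its class, each restriction runs over the restricted class, independently of the others
  (\<open>restrictions_eq\<close>). Parametrising \<open>Q\<close> by \<open>A\<close> counts everything
  twice on the left and \<open>2 ^ n\<close> times on the right: this is the factor \<open>1 / 2\<close>
  and the factor \<open>2\<close> for each region.\<close>

section \<open>Parity and counting\<close>

text \<open>A two-valued function that is locally constant off a finite set has different values at the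
  two ends exactly if it jumps an odd number of times in between. Its values on \<open>T\<close> itself
  are arbitrary, hence a jump compares nearby values on the two sides.\<close>

lemma odd_jumps_iff:
  fixes c :: "real \<Rightarrow> bool"
  assumes "finite T" "a < b" "a \<notin> T" "b \<notin> T"
    and const: "\<And>s u. a \<le> s \<Longrightarrow> s \<le> u \<Longrightarrow> u \<le> b \<Longrightarrow> {s..u} \<inter> T = {} \<Longrightarrow> c s = c u"
    and jump: "\<And>t s u. a \<le> s \<Longrightarrow> s < t \<Longrightarrow> t < u \<Longrightarrow> u \<le> b \<Longrightarrow> {s..u} \<inter> T = {t} \<Longrightarrow> J t \<longleftrightarrow> c s \<noteq> c u"
  shows "odd (card {t \<in> T. a < t \<and> t < b \<and> J t}) \<longleftrightarrow> c a \<noteq> c b"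
  using assms(2,4) const jump
proof (induction "card (T \<inter> {a..b})" arbitrary: b rule: less_induct)
  case (less b)
  show ?case
  proof (cases "T \<inter> {a..b} = {}")
    case True
    have none: "{t \<in> T. a < t \<and> t < b \<and> J t} = {}" using True by auto
    have "c a = c b" using less.prems True by (intro less.prems(3)) auto
    then show ?thesis unfolding none by simp
  next
    case False
    have fin: "finite (T \<inter> {a..b})" using assms(1) by simp
    define m where "m = Max (T \<inter> {a..b})"
    have m: "m \<in> T" "a < m" "m < b" 
      using Max_in[OF fin False] less.prems(2) assms(3) unfolding m_def
      by (auto simp: less_le)
    have mmax: "t \<le> m" if "t \<in> T" "a \<le> t" "t \<le> b" for t
      unfolding m_def using fin that by auto
    \<comment> \<open>Shorten the interval to end just before its last exceptional point \<open>m\<close>.\<close>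
    define q where "q = Max (insert a (T \<inter> {a..<m}))"
    have fin2: "finite (insert a (T \<inter> {a..<m}))" using assms(1) by simp
    have q: "a \<le> q" "q < m" "\<And>t. t \<in> T \<Longrightarrow> a \<le> t \<Longrightarrow> t < m \<Longrightarrow> t \<le> q"
      unfolding q_def using fin2 m(2) by (auto simp: Max_ge_iff)
    define b' where "b' = (q + m) / 2"
    have b': "q < b'" "b' < m" "a < b'" using q unfolding b'_def by auto
    have nT: "b' \<notin> T" using b' q(3)[of b'] by auto
    have eq: "{b'..b} \<inter> T = {m}"
      using m b' mmax q(3) by (force simp: not_less)
    have "m \<in> T \<inter> {a..b}" "m \<notin> T \<inter> {a..b'}" "T \<inter> {a..b'} \<subseteq> T \<inter> {a..b}"
      using m b' by auto
    then have sub: "T \<inter> {a..b'} \<subset> T \<inter> {a..b}" by blast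
    have IH: "odd (card {t \<in> T. a < t \<and> t < b' \<and> J t}) \<longleftrightarrow> c a \<noteq> c b'"
      using b' m nT sub fin by (intro less.hyps less.prems(3,4) psubset_card_mono) auto
    have Jm: "J m \<longleftrightarrow> c b' \<noteq> c b"
      using less.prems(4)[of b' m b] b' m eq by auto
    have split: "{t \<in> T. a < t \<and> t < b \<and> J t} = {t \<in> T. a < t \<and> t < b' \<and> J t} \<union> (if J m then {m} else {})"
    proof -
      have "t < b' \<or> t = m" if "t \<in> T" "a < t" "t < b" for t
        using eq that by fastforce
      then show ?thesis using m b' by auto
    qed
    have "m \<notin> {t \<in> T. a < t \<and> t < b' \<and> J t}" using b' by auto
    then have "odd (card {t \<in> T. a < t \<and> t < b \<and> J t}) \<longleftrightarrow>
        (odd (card {t \<in> T. a < t \<and> t < b' \<and> J t}) \<noteq> J m)"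
      unfolding split using assms(1) by (cases "J m") simp_all
    then show ?thesis unfolding IH Jm by blast
  qed
qed

lemma even_card_sym_diff:
  assumes "finite A" "finite B"
  shows "even (card (sym_diff A B)) \<longleftrightarrow> (even (card A) \<longleftrightarrow> even (card B))"
proof -
  have "card A = card (A - B) + card (A \<inter> B)" "card B = card (B - A) + card (A \<inter> B)"
    using assms by (metis card_Diff_subset_Int card_mono finite_Int inf_le1 le_add_diff_inverse2,
                    metis Int_commute card_Diff_subset_Int card_mono finite_Int inf_le1 le_add_diff_inverse2)
  moreover have "card (sym_diff A B) = card (A - B) + card (B - A)"
    using assms by (intro card_Un_disjoint) auto
  ultimately show ?thesis by auto
qed

lemma sum_constant_fibres:
  fixes F :: "'b \<Rightarrow> real"
  assumes "finite S" "\<And>x. x \<in> S \<Longrightarrow> card {y \<in> S. \<phi> y = \<phi> x} = c"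
  shows "(\<Sum>x\<in>S. F (\<phi> x)) = real c * (\<Sum>y\<in>\<phi> ` S. F y)"
proof -
  have "(\<Sum>x\<in>S. F (\<phi> x)) = (\<Sum>y\<in>\<phi> ` S. \<Sum>x\<in>{x. x \<in> S \<and> \<phi> x = y}. F (\<phi> x))"
    by (rule sum.image_gen[OF assms(1)])
  also have "\<dots> = (\<Sum>y\<in>\<phi> ` S. real c * F y)"
  proof (rule sum.cong[OF refl])
    fix y assume "y \<in> \<phi> ` S"
    then obtain x where x: "x \<in> S" "y = \<phi> x" by blast
    have "(\<Sum>x\<in>{x. x \<in> S \<and> \<phi> x = y}. F (\<phi> x)) = (\<Sum>x\<in>{x \<in> S. \<phi> x = y}. F y)"
      by (rule sum.cong) auto
    then show "(\<Sum>x\<in>{x. x \<in> S \<and> \<phi> x = y}. F (\<phi> x)) = real c * F y"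
      using assms(2)[OF x(1)] x(2) by simp
  qed
  finally show ?thesis by (simp add: sum_distrib_left)
qed

section \<open>Components of the complement of a closed set\<close>

text \<open>Components of open sets have to be open; the charts provide this.\<close>

lemma locally_connected_closed_orientable_surface:
  assumes "closed_orientable_surface X"
  shows "locally_connected_space X"
proof -
  obtain A where A: "oriented_atlas X A"
    using assms unfolding closed_orientable_surface_def by blast
  have "\<exists>N. openin X N \<and> connectedin X N \<and> x \<in> N \<and> N \<subseteq> W" if W: "openin X W" "x \<in> W" for W x
  proof -
    have "x \<in> topspace X" using W openin_subset by blast
    then obtain U h where "(U, h) \<in> A" and x: "x \<in> U"
      using A unfolding oriented_atlas_def by blast
    then have "chart X U h" using A unfolding oriented_atlas_def by auto
    then have U: "openin X U" and hU: "open (h ` U)"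
      and h: "homeomorphic_map (subtopology X U) (top_of_set (h ` U)) h"
      unfolding chart_def by auto
    have "locally_connected_space (top_of_set (h ` U))"
      unfolding locally_connected_space
    proof (intro allI impI)
      fix V y assume V: "openin (top_of_set (h ` U)) V \<and> y \<in> V"
      then have "open V" using hU openin_open_eq by blast
      then obtain r where "r > 0" "ball y r \<subseteq> V" using V open_contains_ball by blast
      moreover have "V \<subseteq> h ` U" using V openin_imp_subset by blast
      ultimately show "\<exists>N. openin (top_of_set (h ` U)) N \<and> connectedin (top_of_set (h ` U)) N \<and> y \<in> N \<and> N \<subseteq> V"
        using hU by (intro exI[of _ "ball y r"])
          (auto simp: connectedin_subtopology openin_open_eq)
    qed
    then have lc: "locally_connected_space (subtopology X U)"
      using homeomorphic_locally_connected_space[OF homeomorphic_map_imp_homeomorphic_space[OF h]] by blast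
    have "openin (subtopology X U) (W \<inter> U)"
      using W openin_subtopology by blast
    then obtain N where "openin (subtopology X U) N" "connectedin (subtopology X U) N" "x \<in> N" "N \<subseteq> W \<inter> U"
      using lc W x unfolding locally_connected_space by (metis IntI)
    then show ?thesis using U
      by (metis connectedin_subtopology openin_open_subtopology le_inf_iff)
  qed
  then show ?thesis unfolding locally_connected_space by blast
qed

text \<open>With the whole graph as \<open>Y\<close> the components below are the faces, with the
  support of a set of edges they are its regions.\<close>

locale cut_space =
  fixes X :: "'a topology" and Y :: "'a set"
  assumes locally_connected: "locally_connected_space X" and closed_cut: "closedin X Y"
begin

definition comps :: "'a set set" where
  "comps = connected_components_of (subtopology X (topspace X - Y))"

definition comp_at :: "'a \<Rightarrow> 'a set" where
  "comp_at y = connected_component_of_set (subtopology X (topspace X - Y)) y"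

text \<open>At an inner point of an edge these are the components on its two sides.\<close>

definition adherent :: "'a \<Rightarrow> 'a set set" where
  "adherent y = {f \<in> comps. y \<in> X closure_of f}"

lemma openin_comps: "f \<in> comps \<Longrightarrow> openin X f"
  unfolding comps_def
  using locally_connected closed_cut locally_connected_space_open_connected_components by blast

lemma connectedin_comps: "f \<in> comps \<Longrightarrow> connectedin X f"
  unfolding comps_def using connectedin_connected_components_of connectedin_subtopology by blast

lemma comps_subset: "f \<in> comps \<Longrightarrow> f \<subseteq> topspace X - Y"
  unfolding comps_def using connected_components_of_subset by fastforce

lemma comp_at: 
  assumes "y \<in> topspace X" "y \<notin> Y"
  shows "comp_at y \<in> comps" "y \<in> comp_at y"
  using assms unfolding comps_def comp_at_def
  by (auto simp: connected_component_in_connected_components_of connected_component_of_refl)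

lemma comp_at_eq: "f \<in> comps \<Longrightarrow> y \<in> f \<Longrightarrow> comp_at y = f"
  using comp_at[of y] comps_subset[of f] 
    connected_components_of_overlap[of f "subtopology X (topspace X - Y)" "comp_at y"]
  unfolding comps_def[symmetric] by blast

lemma comps_disjoint: "f \<in> comps \<Longrightarrow> f' \<in> comps \<Longrightarrow> y \<in> f \<Longrightarrow> y \<in> f' \<Longrightarrow> f = f'"
  using comp_at_eq by blast

lemma connected_subset_comp:
  assumes "connectedin X C" "C \<inter> Y = {}" "f \<in> comps" "C \<inter> f \<noteq> {}"
  shows "C \<subseteq> f"
proof -
  have "connectedin (subtopology X (topspace X - Y)) C"
    using assms connectedin_subset_topspace[of X C] by (auto simp: connectedin_subtopology)
  then show ?thesis
    using assms(3,4) connected_components_of_maximal[of f "subtopology X (topspace X - Y)" C]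
    unfolding comps_def disjnt_def by blast
qed

lemma comp_at_cong:
  assumes "connectedin X C" "C \<inter> Y = {}" "y \<in> C" "z \<in> C"
  shows "comp_at y = comp_at z"
proof -
  have z: "z \<in> topspace X" "z \<notin> Y" using assms connectedin_subset_topspace by blast+
  have "C \<subseteq> comp_at z"
    using assms comp_at[OF z] by (intro connected_subset_comp) auto
  then show ?thesis using comp_at_eq comp_at(1)[OF z] assms(3) by blast
qed

end

section \<open>Angles\<close>

lemma cis_inj_near:
  assumes "cis a = cis b" "\<bar>a - b\<bar> < 2 * pi"
  shows "a = b"
proof -
  have "cis (a - b) = 1" using assms(1) by (simp flip: cis_divide)
  then have "cos (a - b) = 1" by (simp add: complex_eq_iff)
  then obtain n :: int where n: "a - b = of_int n * 2 * pi" using cos_one_2pi_int by blast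
  then have "\<bar>of_int n :: real\<bar> * (2*pi) < 1 * (2 * pi)" using assms(2) by (simp add: abs_mult)
  then have "\<bar>of_int n :: real\<bar> < 1" using mult_less_cancel_right_pos[of "2*pi"] pi_gt_zero by (metis mult_pos_pos zero_less_numeral)
  then have "n = 0" by linarith
  then show ?thesis using n by simp
qed

lemma ex_angle_near:
  obtains t where "cis t = cis s" "a \<le> t" "t < a + 2 * pi"
proof
  let ?z = "cis (s - a)"
  show "cis (a + Arg2pi ?z) = cis s"
  proof -
    have "?z = cis (Arg2pi ?z)"
      using Arg2pi_eq[of ?z] by (simp add: cis_conv_exp)
    then have "cis a * cis (Arg2pi ?z) = cis a * ?z" by simp
    then show ?thesis by (simp add: cis_mult)
  qed
  show "a \<le> a + Arg2pi ?z" "a + Arg2pi ?z < a + 2 * pi"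
    using Arg2pi_ge_0 Arg2pi_lt_2pi by auto
qed

lemma finite_angles:
  assumes "finite D"
  shows "finite {t. a \<le> t \<and> t \<le> a + 2 * pi \<and> cis t \<in> D}"
proof -
  have "inj_on cis {t. a \<le> t \<and> t < a + 2 * pi}"
    by (intro inj_onI cis_inj_near) auto
  then have "finite {t \<in> {t. a \<le> t \<and> t < a + 2 * pi}. cis t \<in> D}"
    using finite_vimage_IntI[OF assms, of cis "{t. a \<le> t \<and> t < a + 2 * pi}"]
    by (simp add: vimage_def Int_def conj_commute)
  then have "finite (insert (a + 2*pi) {t \<in> {t. a \<le> t \<and> t < a + 2 * pi}. cis t \<in> D})" by simp
  then show ?thesis by (rule rev_finite_subset) auto
qed

lemma ex_isolating:
  assumes "finite D"
  obtains e where "0 < e" "e < pi" "\<And>s. s \<noteq> t \<Longrightarrow> \<bar>s - t\<bar> \<le> e \<Longrightarrow> cis s \<notin> D"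
proof -
  let ?A = "{s. (t-pi) \<le> s \<and> s \<le> (t-pi) + 2 * pi \<and> cis s \<in> D}"
  obtain d where d: "d > 0" "\<And>s. s \<in> ?A \<Longrightarrow> s \<noteq> t \<Longrightarrow> d \<le> dist t s"
    using finite_set_avoid[OF finite_angles[OF assms]] by blast
  show ?thesis
  proof
    show "0 < min (d/2) (pi/2)" "min (d/2) (pi/2) < pi" using d(1) by (auto simp: min_def)
    fix s assume s: "s \<noteq> t" "\<bar>s - t\<bar> \<le> min (d/2) (pi/2)"
    show "cis s \<notin> D"
    proof
      assume "cis s \<in> D"
      moreover have "\<bar>s - t\<bar> \<le> pi" using s(2) pi_gt_zero by linarith
      ultimately have "s \<in> ?A" by (auto simp: abs_le_iff)
      then show False using d(2)[of s] s d(1) by (auto simp: dist_real_def abs_minus_commute)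
    qed
  qed
qed

section \<open>Sectors of a star\<close>

text \<open>The data of \<^const>\<open>locally_star\<close> at the point \<open>x\<close>, with
  \<open>g\<close> as the inverse of the chart \<open>h\<close>: in the disc \<open>U\<close> the cut
  consists of the radii with directions in \<open>D\<close>.\<close>

locale star_chart = cut_space +
  fixes U :: "'a set" and h :: "'a \<Rightarrow> complex" and g :: "complex \<Rightarrow> 'a" and D :: "complex set"
    and x :: 'a
  assumes U_open: "openin X U" and xU: "x \<in> U"
    and hg: "homeomorphic_maps (subtopology X U) (top_of_set (ball 0 1)) h g"
    and hx: "h x = 0"
    and finite_D: "finite D" and D_sphere: "D \<subseteq> sphere 0 1"
    and star: "h ` (U \<inter> Y) = insert 0 {of_real t * w | t w. w \<in> D \<and> 0 \<le> t \<and> t < 1}"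
begin

lemma U_subset: "U \<subseteq> topspace X" using U_open openin_subset by blast

lemma g_in: "norm z < 1 \<Longrightarrow> g z \<in> U" and h_g: "norm z < 1 \<Longrightarrow> h (g z) = z"
  using hg U_subset unfolding homeomorphic_maps_def continuous_map_def by (auto simp: Int_absorb1)

lemma h_in: "y \<in> U \<Longrightarrow> norm (h y) < 1" and g_h: "y \<in> U \<Longrightarrow> g (h y) = y"
  using hg U_subset unfolding homeomorphic_maps_def continuous_map_def by (auto simp: Int_absorb1)

lemma g_0: "g 0 = x" using g_h[OF xU] hx by simp

lemma continuous_g: "continuous_map (top_of_set (ball 0 1)) X g"
  using hg continuous_map_into_fulltopology unfolding homeomorphic_maps_def by blast

lemma continuous_h: "continuous_map (subtopology X U) euclidean h"
  using hg continuous_map_into_fulltopology unfolding homeomorphic_maps_def by blast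

lemma openin_image_g:
  assumes "open S" "S \<subseteq> ball 0 1"
  shows "openin X (g ` S)"
proof -
  have "homeomorphic_map (top_of_set (ball 0 1)) (subtopology X U) g"
    using hg homeomorphic_maps_map homeomorphic_maps_sym by blast
  moreover have "openin (top_of_set (ball (0::complex) 1)) S"
    using assms by (simp add: openin_open_eq)
  ultimately have "openin (subtopology X U) (g ` S)"
    using homeomorphic_map_openness_eq by blast
  then show ?thesis using U_open openin_trans_full by blast
qed

lemma open_preimage_g:
  assumes "openin X V"
  shows "open {z. norm z < 1 \<and> g z \<in> V}"
proof -
  have "openin (top_of_set (ball 0 1)) {z \<in> topspace (top_of_set (ball 0 1)). g z \<in> V}"
    using continuous_g assms unfolding continuous_map_def by blast
  then show ?thesis by (simp add: openin_open_eq)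
qed

lemma g_mem_iff:
  assumes "norm z < 1"
  shows "g z \<in> Y \<longleftrightarrow> z = 0 \<or> sgn z \<in> D"
proof -
  have "g z \<in> Y \<longleftrightarrow> z \<in> h ` (U \<inter> Y)"
  proof
    assume "g z \<in> Y"
    then have "h (g z) \<in> h ` (U \<inter> Y)" using g_in[OF assms] by blast
    then show "z \<in> h ` (U \<inter> Y)" using h_g[OF assms] by simp
  next
    assume "z \<in> h ` (U \<inter> Y)"
    then show "g z \<in> Y" using g_h by auto
  qed
  also have "\<dots> \<longleftrightarrow> z = 0 \<or> sgn z \<in> D"
  proof (cases "z = 0")
    case False
    have "sgn z = w" if "z = of_real t * w" "w \<in> D" "0 \<le> t" for t w
    proof -
      have "norm w = 1" using that(2) D_sphere by auto
      moreover have "t > 0" using that False by (cases "t = 0") auto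
      ultimately show ?thesis using that(1) by (simp add: sgn_mult sgn_eq[of w] sgn_of_real)
    qed
    moreover have "z = of_real (norm z) * sgn z" using False by (simp add: sgn_eq)
    ultimately show ?thesis unfolding star using False assms
      by (auto intro!: exI[of _ "norm z"] exI[of _ "sgn z"])
  qed (simp add: star)
  finally show ?thesis .
qed

lemma x_mem: "x \<in> Y" using g_mem_iff[of 0] g_0 by simp

lemma g_rcis:
  assumes "0 < r" "r < 1"
  shows "g (rcis r t) \<in> Y \<longleftrightarrow> cis t \<in> D" "g (rcis r t) \<in> topspace X"
proof -
  have "norm (rcis r t) < 1" "rcis r t \<noteq> 0" "sgn (rcis r t) = cis t"
    using assms by (auto simp: rcis_def sgn_mult norm_mult sgn_of_real)
  then show "g (rcis r t) \<in> Y \<longleftrightarrow> cis t \<in> D" "g (rcis r t) \<in> topspace X"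
    using g_mem_iff[of "rcis r t"] g_in[of "rcis r t"] U_subset by auto
qed

text \<open>The component seen in direction \<open>t\<close>; by the next lemma the radius
  \<open>1/2\<close> could be any other. It is meaningful if \<open>t\<close> is not the direction of a
  radius of the star.\<close>

definition side :: "real \<Rightarrow> 'a set" where
  "side t = comp_at (g (rcis (1/2) t))"

text \<open>A sector of the punctured disc without radii of the star is connected and avoids the cut.\<close>

lemma sector:
  assumes "\<And>v. s \<le> v \<Longrightarrow> v \<le> u \<Longrightarrow> cis v \<notin> D"
    and t: "s \<le> t" "t \<le> u" "s \<le> t'" "t' \<le> u" and r: "0 < r" "r < 1"
  shows "comp_at (g (rcis r t)) = side t'"
proof -
  let ?R = "(\<lambda>(r, t). rcis r t) ` ({0<..<1} \<times> {s..u})"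
  have "connected ({0<..<1::real} \<times> {s..u})"
    by (intro connected_Times) auto
  then have "connected ?R"
    by (rule connected_continuous_image[rotated])
      (auto simp: rcis_def case_prod_unfold cis_conv_exp intro!: continuous_intros)
  then have "connectedin (top_of_set (ball 0 1)) ?R"
    by (auto simp: connectedin_subtopology)
  then have "connectedin X (g ` ?R)"
    using connectedin_continuous_map_image continuous_g by blast
  moreover have "g ` ?R \<inter> Y = {}" using assms(1) g_rcis(1) by force
  moreover have "g (rcis r t) \<in> g ` ?R" "g (rcis (1/2) t') \<in> g ` ?R"
    using t r by force+
  ultimately show ?thesis unfolding side_def by (rule comp_at_cong)
qed

lemma side_in_comps: "cis t \<notin> D \<Longrightarrow> side t \<in> comps"
  using g_rcis[of "1/2" t] comp_at unfolding side_def by simp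

lemma side_eq: "cis s = cis t \<Longrightarrow> side s = side t"
  unfolding side_def rcis_def by simp

lemma sector_side:
  assumes "\<And>v. min s t \<le> v \<Longrightarrow> v \<le> max s t \<Longrightarrow> cis v \<notin> D"
  shows "side s = side t"
  using sector[of "min s t" "max s t" s t "1/2"] assms unfolding side_def by auto

text \<open>Moving a point towards the centre does not change its component, so the point may be
  replaced by its direction.\<close>

lemma comp_meeting_chart:
  assumes "f \<in> comps" "z \<in> f" "z \<in> U"
  obtains t where "cis t \<notin> D" "f = side t"
proof -
  let ?w = "h z"
  have w: "norm ?w < 1" "g ?w = z" using assms h_in g_h by auto
  then have "?w \<noteq> 0" "sgn ?w \<notin> D"
    using g_mem_iff[of ?w] assms comps_subset by auto
  then have *: "cis (Arg ?w) \<notin> D" by (simp add: cis_Arg)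
  have "comp_at (g (rcis (norm ?w) (Arg ?w))) = side (Arg ?w)"
    using * w \<open>?w \<noteq> 0\<close> by (intro sector[of "Arg ?w" "Arg ?w"]) (auto simp: order_antisym)
  then have "f = side (Arg ?w)"
    using comp_at_eq[OF assms(1,2)] w(2) by (simp add: rcis_cmod_Arg)
  then show ?thesis using that * by blast
qed

text \<open>On \<open>[0, 2\<pi>)\<close> the side depends only on which of the finitely many radii come
  before the direction.\<close>

lemma finite_sides: "finite (side ` {t. cis t \<notin> D})"
proof -
  define T where "T = {t. 0 \<le> t \<and> t \<le> 0 + 2 * pi \<and> cis t \<in> D}"
  define S where "S = {t. 0 \<le> t \<and> t < 2 * pi \<and> cis t \<notin> D}"
  have "finite T" unfolding T_def using finite_angles[OF finite_D] .
  have eq: "side s = side t" if "s \<in> S" "t \<in> S" "{v\<in>T. v < s} = {v\<in>T. v < t}" for s t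
  proof (rule sector_side)
    fix v assume v: "min s t \<le> v" "v \<le> max s t"
    show "cis v \<notin> D"
    proof
      assume "cis v \<in> D"
      then have ne: "v \<noteq> s" "v \<noteq> t" using that(1,2) unfolding S_def by auto
      have "0 \<le> v" "v \<le> 2 * pi" using that(1,2) v unfolding S_def by (auto simp: min_def max_def split: if_splits)
      then have "v \<in> T" using \<open>cis v \<in> D\<close> unfolding T_def by simp
      then have "v < s \<longleftrightarrow> v < t" using that(3) by blast
      then show False using v ne by linarith
    qed
  qed
  have "side ` {t. cis t \<notin> D} \<subseteq> (\<lambda>K. side (SOME t. t \<in> S \<and> {v\<in>T. v < t} = K)) ` Pow T"
  proof
    fix f assume "f \<in> side ` {t. cis t \<notin> D}"
    then obtain t where t: "f = side t" "cis t \<notin> D" by blast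
    obtain t' where a: "cis t' = cis t" "0 \<le> t'" "t' < 0 + 2 * pi" using ex_angle_near .
    have t': "t' \<in> S" "f = side t'" using t a side_eq[OF a(1)] unfolding S_def by auto
    let ?K = "{v\<in>T. v < t'}"
    let ?s = "SOME t. t \<in> S \<and> {v\<in>T. v < t} = ?K"
    have "?s \<in> S \<and> {v\<in>T. v < ?s} = ?K" by (rule someI[of _ t']) (use t' in auto)
    then have "f = side ?s" using eq[of ?s t'] t' by blast
    then show "f \<in> (\<lambda>K. side (SOME t. t \<in> S \<and> {v\<in>T. v < t} = K)) ` Pow T" by blast
  qed
  then show ?thesis using \<open>finite T\<close> finite_subset by blast
qed

lemma adherent_centre: "adherent x = side ` {t. cis t \<notin> D}"
proof (intro equalityI subsetI)
  fix f assume "f \<in> adherent x"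
  then have f: "f \<in> comps" "x \<in> X closure_of f" unfolding adherent_def by auto
  then obtain z where "z \<in> f" "z \<in> U" using U_open xU unfolding in_closure_of by blast
  then show "f \<in> side ` {t. cis t \<notin> D}" using comp_meeting_chart f by blast
next
  fix f assume "f \<in> side ` {t. cis t \<notin> D}"
  then obtain t where t: "cis t \<notin> D" "f = side t" by blast
  have "\<exists>y. y \<in> f \<and> y \<in> V" if V: "x \<in> V" "openin X V" for V
  proof -
    have "0 \<in> {z. norm z < 1 \<and> g z \<in> V}" using V(1) g_0 by simp
    then obtain d where d: "d > 0" "ball 0 d \<subseteq> {z. norm z < 1 \<and> g z \<in> V}"
      using open_preimage_g[OF V(2)] open_contains_ball by meson
    define r where "r = min d 1 / 2"
    have r: "0 < r" "r < 1" "r < d" using d(1) unfolding r_def by auto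
    then have "rcis r t \<in> ball 0 d" by (simp add: rcis_def norm_mult)
    then have "g (rcis r t) \<in> V" using d(2) by blast
    moreover have "comp_at (g (rcis r t)) = f"
      unfolding t(2) using t(1) r by (intro sector[of t t]) (auto simp: order_antisym)
    ultimately show ?thesis using comp_at(2) g_rcis[OF r(1,2), of t] t(1) by blast
  qed
  then have "x \<in> X closure_of f" using xU U_subset unfolding in_closure_of by blast
  then show "f \<in> adherent x" using side_in_comps t unfolding adherent_def by blast
qed

text \<open>A small disc around a point of a radius meets only the two sectors along that radius, and
  both of them reach the point.\<close>

lemma adherent_ray:
  assumes "cis t \<in> D" and e: "0 < e" "\<And>s. s \<noteq> t \<Longrightarrow> \<bar>s - t\<bar> \<le> e \<Longrightarrow> cis s \<notin> D"
    and r: "0 < r" "r < 1"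
  shows "adherent (g (rcis r t)) = {side (t - e), side (t + e)}"
proof (intro equalityI subsetI)
  fix f assume "f \<in> adherent (g (rcis r t))"
  then have f: "f \<in> comps" "g (rcis r t) \<in> X closure_of f" unfolding adherent_def by auto
  \<comment> \<open>Dividing by \<open>cis t\<close> turns the ray to the positive axis, where \<open>Arg\<close> is continuous.\<close>
  have "isCont (\<lambda>z. Arg (z / cis t)) (rcis r t)"
    using r by (intro continuous_within_compose3[OF continuous_at_Arg, where f="\<lambda>z. z / cis t"] continuous_intros)
      (auto simp: rcis_def)
  then have "(\<lambda>z. \<bar>Arg (z / cis t)\<bar>) \<midarrow>rcis r t\<rightarrow> \<bar>Arg (rcis r t / cis t)\<bar>"
    unfolding isCont_def by (rule tendsto_rabs)
  moreover have "\<bar>Arg (rcis r t / cis t)\<bar> < e" using r e by (simp add: rcis_def)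
  ultimately have "\<forall>\<^sub>F z in at (rcis r t). \<bar>Arg (z / cis t)\<bar> < e"
    by (rule order_tendstoD)
  then have "\<forall>\<^sub>F z in nhds (rcis r t). \<bar>Arg (z / cis t)\<bar> < e"
    using \<open>\<bar>Arg (rcis r t / cis t)\<bar> < e\<close> by (simp add: eventually_at_filter eventually_nhds)  metis
  moreover have "\<forall>\<^sub>F z in nhds (rcis r t). norm z < 1"
    using r eventually_nhds_in_open[of "ball 0 1" "rcis r t"] by (simp add: rcis_def norm_mult)
  ultimately have "\<forall>\<^sub>F z in nhds (rcis r t). \<bar>Arg (z / cis t)\<bar> < e \<and> norm z < 1"
    by (rule eventually_conj)
  then obtain S where S: "open S" "rcis r t \<in> S" "\<And>z. z \<in> S \<Longrightarrow> \<bar>Arg (z / cis t)\<bar> < e \<and> norm z < 1"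
    unfolding eventually_nhds by blast
  have "openin X (g ` S)" using S by (intro openin_image_g) auto
  moreover have "g (rcis r t) \<in> g ` S" using S by blast
  ultimately obtain z where z: "z \<in> S" "g z \<in> f" using f(2) unfolding in_closure_of by blast
  have zn: "norm z < 1" using S z by blast
  have nz: "z \<noteq> 0" "sgn z \<notin> D" using g_mem_iff[OF zn] comps_subset[OF f(1)] z(2) by auto
  define a where "a = t + Arg (z / cis t)"
  have a: "\<bar>a - t\<bar> < e" using S z unfolding a_def by auto
  have "cis (Arg (z / cis t)) = sgn (z / cis t)" using nz by (intro cis_Arg) auto
  then have "cis a = sgn z" unfolding a_def by (simp add: cis_mult[symmetric] sgn_divide)
  then have za: "z = rcis (norm z) a" using nz by (simp add: rcis_def sgn_eq)
  have "a \<noteq> t" using nz \<open>cis a = sgn z\<close> assms(1) by auto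
  have fz: "comp_at (g (rcis (norm z) a)) = f" using comp_at_eq[OF f(1) z(2)] za by simp
  have zp: "0 < norm z" "norm z < 1" using nz zn by auto
  show "f \<in> {side (t - e), side (t + e)}"
  proof (cases "a < t")
    case True
    have "comp_at (g (rcis (norm z) a)) = side (t - e)"
      using True a zp e by (intro sector[of "t-e" a]) auto
    then show ?thesis using fz by simp
  next
    case False
    have "comp_at (g (rcis (norm z) a)) = side (t + e)"
      using False \<open>a \<noteq> t\<close> a zp e by (intro sector[of a "t+e"]) auto
    then show ?thesis using fz by simp
  qed
next
  fix f assume f: "f \<in> {side (t - e), side (t + e)}"
  \<comment> \<open>Both sides are treated at once, approaching the ray from \<open>t + b\<close>.\<close>
  define b where "b = (if f = side (t - e) then -e else e)"
  have b: "f = side (t + b)" "\<bar>b\<bar> = e" using f e(1) unfolding b_def by auto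
  have "\<exists>y. y \<in> f \<and> y \<in> V" if V: "g (rcis r t) \<in> V" "openin X V" for V
  proof -
    have "rcis r t \<in> {z. norm z < 1 \<and> g z \<in> V}" using V(1) r by (simp add: rcis_def norm_mult)
    moreover have "((\<lambda>q. rcis r (t + b * q)) \<longlongrightarrow> rcis r (t + b * 0)) (at_right 0)"
      unfolding rcis_def cis_conv_exp by (intro tendsto_intros)
    ultimately have "\<forall>\<^sub>F q in at_right 0. rcis r (t + b * q) \<in> {z. norm z < 1 \<and> g z \<in> V}"
      using open_preimage_g[OF V(2)] by (intro topological_tendstoD) auto
    moreover have "\<forall>\<^sub>F q in at_right (0::real). 0 < q \<and> q < 1"
      unfolding eventually_at_right_field by (auto intro!: exI[of _ 1])
    ultimately have "\<forall>\<^sub>F q in at_right 0. g (rcis r (t + b * q)) \<in> V \<and> 0 < q \<and> q < 1"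
      by eventually_elim auto
    then obtain q where q: "g (rcis r (t + b * q)) \<in> V" "0 < q" "q < 1"
      using eventually_happens[of _ "at_right (0::real)"] by auto
    have bq: "\<bar>b * q\<bar> \<le> e" "b * q \<noteq> 0" using q b(2) e(1) by (auto simp: abs_mult)
    have bsign: "0 < b * q \<longleftrightarrow> 0 < b" "b \<noteq> 0" using q b(2) e(1) by (auto simp: zero_less_mult_iff)
    have off: "cis v \<notin> D" if "min (t + b * q) (t + b) \<le> v" "v \<le> max (t + b * q) (t + b)" for v
    proof (rule e(2))
      show "v \<noteq> t" "\<bar>v - t\<bar> \<le> e"
        using that bq b(2) bsign by (auto simp: min_def max_def abs_if split: if_splits)
    qed
    have "comp_at (g (rcis r (t + b * q))) = f"
      unfolding b(1) using off r by (intro sector[of "min (t + b * q) (t + b)" "max (t + b * q) (t + b)"]) auto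
    moreover have "cis (t + b * q) \<notin> D" using off by auto
    ultimately show ?thesis using comp_at(2) g_rcis[OF r, of "t + b * q"] q(1) by blast
  qed
  moreover have "g (rcis r t) \<in> topspace X" using g_rcis r by blast
  ultimately have "g (rcis r t) \<in> X closure_of f" unfolding in_closure_of by blast
  moreover have "cis (t + b) \<notin> D" using b(2) e by (intro e(2)) auto
  ultimately show "f \<in> adherent (g (rcis r t))" using side_in_comps b(1) unfolding adherent_def by blast
qed

lemma cis_angle:
  assumes "w \<in> D"
  obtains t where "cis t = w" "a \<le> t" "t < a + 2 * pi"
proof -
  have "norm w = 1" using assms D_sphere by auto
  then have "cis (Arg w) = w" by (subst cis_Arg) (auto simp: sgn_eq)
  then show ?thesis using ex_angle_near[of "Arg w" a] that by metis
qed

lemma odd_jumps_between: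
  assumes J: "\<And>t e. cis t \<in> D \<Longrightarrow> 0 < e \<Longrightarrow> (\<And>s. s \<noteq> t \<Longrightarrow> \<bar>s - t\<bar> \<le> e \<Longrightarrow> cis s \<notin> D) \<Longrightarrow>
                 J (cis t) \<longleftrightarrow> (side (t - e) \<in> A) \<noteq> (side (t + e) \<in> A)"
    and ab: "a < b" "b \<le> a + 2 * pi" "cis a \<notin> D" "cis b \<notin> D"
  shows "odd (card {t. cis t \<in> D \<and> a < t \<and> t < b \<and> J (cis t)}) \<longleftrightarrow> (side a \<in> A) \<noteq> (side b \<in> A)"
proof -
  let ?T = "{t. a \<le> t \<and> t \<le> a + 2 * pi \<and> cis t \<in> D}"
  have T: "{s..u} \<inter> ?T = {t \<in> {s..u}. cis t \<in> D}" if "a \<le> s" "u \<le> b" for s u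
    using that ab by auto
  have "odd (card {t \<in> ?T. a < t \<and> t < b \<and> J (cis t)}) \<longleftrightarrow> (side a \<in> A) \<noteq> (side b \<in> A)"
  proof (rule odd_jumps_iff)
    show "finite ?T" by (rule finite_angles[OF finite_D])
    show "a < b" "a \<notin> ?T" "b \<notin> ?T" using ab by auto
  next
    fix s u assume "a \<le> s" "s \<le> u" "u \<le> b" "{s..u} \<inter> ?T = {}"
    then have "side s = side u" by (intro sector_side) (auto simp: T)
    then show "(side s \<in> A) = (side u \<in> A)" by simp
  next
    fix t s u assume su: "a \<le> s" "s < t" "t < u" "u \<le> b" "{s..u} \<inter> ?T = {t}"
    then have only: "{v \<in> {s..u}. cis v \<in> D} = {t}" by (simp add: T)
    define e where "e = min (t - s) (u - t)"
    have e: "0 < e" "e \<le> t - s" "e \<le> u - t" using su unfolding e_def by auto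
    have off: "cis v \<notin> D" if "s \<le> v" "v \<le> u" "v \<noteq> t" for v
      using only that by auto
    have "J (cis t) \<longleftrightarrow> (side (t - e) \<in> A) \<noteq> (side (t + e) \<in> A)"
    proof (rule J)
      show "cis t \<in> D" using only by blast
      show "0 < e" by fact
      fix v assume "v \<noteq> t" "\<bar>v - t\<bar> \<le> e"
      then show "cis v \<notin> D" using e by (intro off) auto
    qed
    moreover have "side s = side (t - e)"
      by (rule sector_side, rule off) (use e in auto)
    moreover have "side u = side (t + e)"
      by (rule sector_side, rule off) (use e in auto)
    ultimately show "J (cis t) \<longleftrightarrow> (side s \<in> A) \<noteq> (side u \<in> A)" by simp
  qed
  moreover have "{t \<in> ?T. a < t \<and> t < b \<and> J (cis t)} = {t. cis t \<in> D \<and> a < t \<and> t < b \<and> J (cis t)}"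
    using ab by auto
  ultimately show ?thesis by simp
qed

text \<open>After a full turn the status of the component is the initial one. The predicate
  \<open>J\<close> says of a radius that the status with respect to \<open>A\<close> differs on its two
  sides.\<close>

lemma even_jumping_rays:
  assumes J: "\<And>t e. cis t \<in> D \<Longrightarrow> 0 < e \<Longrightarrow> (\<And>s. s \<noteq> t \<Longrightarrow> \<bar>s - t\<bar> \<le> e \<Longrightarrow> cis s \<notin> D) \<Longrightarrow>
                 J (cis t) \<longleftrightarrow> (side (t - e) \<in> A) \<noteq> (side (t + e) \<in> A)"
  shows "even (card {w \<in> D. J w})"
proof -
  obtain a where a: "cis a \<notin> D"
    using ex_isolating[OF finite_D, of 0] by (metis abs_of_pos diff_zero less_irrefl order_refl)
  let ?S = "{t. cis t \<in> D \<and> a < t \<and> t < a + 2 * pi \<and> J (cis t)}"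
  have per: "cis (a + 2 * pi) = cis a" by (simp flip: cis_mult)
  have "odd (card ?S) \<longleftrightarrow> (side a \<in> A) \<noteq> (side (a + 2 * pi) \<in> A)"
    using a per by (intro odd_jumps_between J) auto
  moreover have "side (a + 2 * pi) = side a" using side_eq per .
  ultimately have "even (card ?S)" by simp
  moreover have "bij_betw cis ?S {w \<in> D. J w}"
  proof (rule bij_betw_imageI)
    show "inj_on cis ?S" by (intro inj_onI cis_inj_near) auto
    show "cis ` ?S = {w \<in> D. J w}"
    proof (intro equalityI subsetI)
      fix w assume w: "w \<in> {w \<in> D. J w}"
      then obtain t where t: "cis t = w" "a \<le> t" "t < a + 2 * pi" using cis_angle by blast
      then have "t \<noteq> a" using a w by auto
      then show "w \<in> cis ` ?S" using t w by (intro image_eqI[of _ _ t]) auto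
    qed auto
  qed
  then have "card ?S = card {w \<in> D. J w}" by (rule bij_betw_same_card)
  ultimately show ?thesis by simp
qed

lemma sides_agree:
  assumes J: "\<And>t e. cis t \<in> D \<Longrightarrow> 0 < e \<Longrightarrow> (\<And>s. s \<noteq> t \<Longrightarrow> \<bar>s - t\<bar> \<le> e \<Longrightarrow> cis s \<notin> D) \<Longrightarrow>
                 (side (t - e) \<in> A) = (side (t + e) \<in> A)"
    and "cis s \<notin> D" "cis t \<notin> D"
  shows "side s \<in> A \<longleftrightarrow> side t \<in> A"
proof -
  obtain t' where t': "cis t' = cis t" "s \<le> t'" "t' < s + 2 * pi" using ex_angle_near .
  have "side s \<in> A \<longleftrightarrow> side t' \<in> A"
  proof (cases "t' = s")
    case False
    then have "odd (card {v. cis v \<in> D \<and> s < v \<and> v < t' \<and> (\<lambda>_. False) (cis v)})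
        \<longleftrightarrow> (side s \<in> A) \<noteq> (side t' \<in> A)"
      using t' assms by (intro odd_jumps_between) auto
    then show ?thesis by simp
  qed simp
  then show ?thesis using side_eq[OF t'(1)] by simp
qed

text \<open>With at most two radii there are at most two sectors, and both lie along any given radius.\<close>

lemma sides_two_rays:
  assumes "card D \<le> 2" and t: "cis t \<in> D"
    and e: "0 < e" "e < pi" "\<And>s. s \<noteq> t \<Longrightarrow> \<bar>s - t\<bar> \<le> e \<Longrightarrow> cis s \<notin> D"
  shows "side ` {s. cis s \<notin> D} = {side (t - e), side (t + e)}"
proof (intro equalityI subsetI)
  fix f assume "f \<in> side ` {s. cis s \<notin> D}"
  then obtain s' where s': "f = side s'" "cis s' \<notin> D" by blast
  obtain s where s: "cis s = cis s'" "t \<le> s" "s < t + 2 * pi" using ex_angle_near .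
  have f: "f = side s" "cis s \<notin> D" using s' s side_eq[OF s(1)] by auto
  have ts: "t < s" using t f(2) s(2) by (cases "t = s") auto
  have "(\<forall>v. t < v \<and> v \<le> s \<longrightarrow> cis v \<notin> D) \<or> (\<forall>v. s \<le> v \<and> v < t + 2 * pi \<longrightarrow> cis v \<notin> D)"
  proof (rule ccontr)
    assume "\<not> ?thesis"
    then obtain v1 v2 where v: "t < v1" "v1 \<le> s" "cis v1 \<in> D" "s \<le> v2" "v2 < t + 2 * pi" "cis v2 \<in> D"
      by blast
    then have "v1 \<noteq> v2" using f(2) by (cases "v1 = s") auto
    then have "cis v1 \<noteq> cis v2" "cis t \<noteq> cis v1" "cis t \<noteq> cis v2"
      using v cis_inj_near[of v1 v2] cis_inj_near[of t v1] cis_inj_near[of t v2] ts by auto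
    then have "card {cis t, cis v1, cis v2} = 3" by simp
    moreover have "card {cis t, cis v1, cis v2} \<le> card D"
      using v t finite_D by (intro card_mono) auto
    ultimately show False using assms(1) by simp
  qed
  then show "f \<in> {side (t - e), side (t + e)}"
  proof
    assume off: "\<forall>v. t < v \<and> v \<le> s \<longrightarrow> cis v \<notin> D"
    have "side s = side (t + e)"
    proof (rule sector_side)
      fix v assume "min s (t + e) \<le> v" "v \<le> max s (t + e)"
      then show "cis v \<notin> D" using off e(1) e(3)[of v] ts by (cases "v \<le> s") auto
    qed
    then show ?thesis using f by simp
  next
    assume off: "\<forall>v. s \<le> v \<and> v < t + 2 * pi \<longrightarrow> cis v \<notin> D"
    have per: "cis v = cis (v - 2 * pi)" for v by (simp flip: cis_divide)
    have "side s = side (t + 2 * pi - e)"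
    proof (rule sector_side)
      fix v assume v: "min s (t + 2 * pi - e) \<le> v" "v \<le> max s (t + 2 * pi - e)"
      show "cis v \<notin> D"
      proof (cases "s \<le> v")
        case True
        then show ?thesis using off v e(1) s(3) by auto
      next
        case False
        then have "cis (v - 2 * pi) \<notin> D" using v s(3) e(1,2) by (intro e(3)) auto
        then show ?thesis using per by metis
      qed
    qed
    also have "side (t + 2 * pi - e) = side (t - e)"
      using per[of "t + 2 * pi - e"] by (intro side_eq) (simp add: algebra_simps)
    finally show ?thesis using f by simp
  qed
next
  fix f assume "f \<in> {side (t - e), side (t + e)}"
  moreover have "cis (t - e) \<notin> D" "cis (t + e) \<notin> D" using e by (auto intro!: e(3))
  ultimately show "f \<in> side ` {s. cis s \<notin> D}" by blast
qed

text \<open>What makes the adherent components locally constant along an edge.\<close>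

lemma adherent_two_rays:
  assumes "card D \<le> 2" "y \<in> U" "y \<in> Y"
  shows "adherent y = adherent x"
proof (cases "h y = 0")
  case True
  then have "y = x" using g_h[OF assms(2)] g_0 by simp
  then show ?thesis by simp
next
  case False
  have z: "norm (h y) < 1" "g (h y) = y" using h_in g_h assms(2) by auto
  then have "sgn (h y) \<in> D" using g_mem_iff[of "h y"] assms(3) False by simp
  then obtain t where t: "cis t = sgn (h y)" using cis_angle by blast
  have tD: "cis t \<in> D" using t \<open>sgn (h y) \<in> D\<close> by simp
  obtain e where e: "0 < e" "e < pi" "\<And>s. s \<noteq> t \<Longrightarrow> \<bar>s - t\<bar> \<le> e \<Longrightarrow> cis s \<notin> D"
    using ex_isolating[OF finite_D] by blast
  have "h y = rcis (norm (h y)) t" using t False by (simp add: rcis_def sgn_eq)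
  then have "adherent y = {side (t - e), side (t + e)}"
    using adherent_ray[OF tD e(1,3), of "norm (h y)"] z False by simp
  also have "\<dots> = adherent x"
    unfolding adherent_centre using sides_two_rays[OF assms(1) tD e] by simp
  finally show ?thesis .
qed

section \<open>Curves leaving the centre of a star\<close>

text \<open>Curves on the cut that leave \<open>x\<close>, are pairwise disjoint apart from
  \<open>x\<close>, and fill the cut near \<open>x\<close> correspond to the radii. Indeed, seen in the
  chart, a curve close to \<open>x\<close> has its direction in the finite set \<open>D\<close>, so the
  direction is constant and the curve covers an initial piece of one radius. Two curves on the same
  radius would meet outside \<open>x\<close>, and a radius without a curve would contain points of the
  cut close to \<open>x\<close> that no curve reaches.\<close>

lemma germs_rays:
  fixes c :: "'k \<Rightarrow> real \<Rightarrow> 'a"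
  assumes "Hausdorff_space X" "finite K"
    and cont: "\<And>k. k \<in> K \<Longrightarrow> continuous_map (top_of_set {0..1}) X (c k)"
    and start: "\<And>k. k \<in> K \<Longrightarrow> c k 0 = x"
    and leave: "\<And>k s. k \<in> K \<Longrightarrow> 0 < s \<Longrightarrow> s \<le> 1 \<Longrightarrow> c k s \<noteq> x"
    and in_cut: "\<And>k s. k \<in> K \<Longrightarrow> 0 < s \<Longrightarrow> s \<le> 1 \<Longrightarrow> c k s \<in> Y"
    and disj: "\<And>k k' s s'. k \<in> K \<Longrightarrow> k' \<in> K \<Longrightarrow> 0 < s \<Longrightarrow> s \<le> 1 \<Longrightarrow> 0 < s' \<Longrightarrow> s' \<le> 1 \<Longrightarrow>
                 c k s = c k' s' \<Longrightarrow> k = k'"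
    and V: "openin X V" "x \<in> V"
    and cover: "\<And>y. y \<in> V \<Longrightarrow> y \<in> Y \<Longrightarrow> y \<noteq> x \<Longrightarrow> \<exists>k\<in>K. \<exists>s. 0 < s \<and> s \<le> 1 \<and> y = c k s"
  obtains \<phi> where "bij_betw \<phi> K D"
    "\<And>k. k \<in> K \<Longrightarrow> \<exists>r s. 0 < r \<and> r < 1 \<and> 0 < s \<and> s \<le> 1 \<and> g (of_real r * \<phi> k) = c k s"
proof -
  have "\<exists>d. 0 < d \<and> d \<le> 1 \<and> (\<forall>s. 0 \<le> s \<and> s \<le> d \<longrightarrow> c k s \<in> U)" if "k \<in> K" for k
  proof -
    let ?S = "{s \<in> {0..1}. c k s \<in> U}"
    have "openin (top_of_set {0..1}) ?S"
      using cont[OF that] U_open unfolding continuous_map_def by simp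
    then have "\<forall>s\<in>?S. \<exists>e>0. ball s e \<inter> {0..1} \<subseteq> ?S"
      using openin_contains_ball[of "{0..1}" ?S] by blast
    moreover have "0 \<in> ?S" using start[OF that] xU by simp
    ultimately obtain d where d: "d > 0" "ball 0 d \<inter> {0..1} \<subseteq> ?S"
      by blast
    have "c k s \<in> U" if "0 \<le> s" "s \<le> min 1 (d/2)" for s
    proof -
      have "s \<in> ball 0 d \<inter> {0..1}" using that d(1) by (auto simp: dist_real_def)
      then show ?thesis using d(2) by blast
    qed
    then show ?thesis using d(1) by (intro exI[of _ "min 1 (d/2)"]) auto
  qed
  then obtain d where d: "\<And>k. k \<in> K \<Longrightarrow> 0 < d k" "\<And>k. k \<in> K \<Longrightarrow> d k \<le> 1"
     "\<And>k s. k \<in> K \<Longrightarrow> 0 \<le> s \<Longrightarrow> s \<le> d k \<Longrightarrow> c k s \<in> U" by metis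
  define p where "p k s = h (c k s)" for k s
  have p_cont: "continuous_on {0..d k} (p k)" if k: "k \<in> K" for k
  proof -
    have "continuous_map (top_of_set {0..d k}) X (c k)"
      using continuous_map_from_subtopology_mono[OF cont[OF k]] d(2)[OF k] by auto
    then have "continuous_map (top_of_set {0..d k}) (subtopology X U) (c k)"
      using d(3)[OF k] by (auto simp: continuous_map_in_subtopology)
    then have "continuous_map (top_of_set {0..d k}) euclidean (h \<circ> c k)"
      using continuous_h continuous_map_compose by blast
    then show ?thesis by (simp add: p_def o_def)
  qed
  have gp: "g (p k s) = c k s" "norm (p k s) < 1" if "k \<in> K" "0 \<le> s" "s \<le> d k" for k s
    using g_h h_in d(3)[OF that] unfolding p_def by auto
  have p0: "p k 0 = 0" if "k \<in> K" for k using start[OF that] hx unfolding p_def by simp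
  have p_nz: "p k s \<noteq> 0" "sgn (p k s) \<in> D" if "k \<in> K" "0 < s" "s \<le> d k" for k s
  proof -
    have s: "s \<le> 1" using that d(2)[of k] by simp
    show nz: "p k s \<noteq> 0"
      using gp(1)[of k s] that leave[OF that(1,2) s] g_0 by auto
    show "sgn (p k s) \<in> D"
      using nz in_cut[OF that(1,2) s] gp[of k s] that g_mem_iff[of "p k s"] by auto
  qed
  define \<phi> where "\<phi> k = sgn (p k (d k))" for k
  have sgn_p: "sgn (p k s) = \<phi> k" if k: "k \<in> K" "0 < s" "s \<le> d k" for k s
  proof -
    have "continuous_on {0<..d k} (\<lambda>s. sgn (p k s))"
      using p_nz(1)[OF k(1)] 
      by (intro continuous_on_sgn continuous_on_subset[OF p_cont[OF k(1)]]) auto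
    moreover have "finite ((\<lambda>s. sgn (p k s)) ` {0<..d k})"
      using p_nz(2)[OF k(1)] by (intro finite_subset[OF _ finite_D]) auto
    ultimately have "(\<lambda>s. sgn (p k s)) constant_on {0<..d k}"
      by (intro continuous_finite_range_constant) auto
    then show ?thesis using k d(1)[OF k(1)] unfolding constant_on_def \<phi>_def by force
  qed
  have p_eq: "p k s = of_real (norm (p k s)) * \<phi> k" if k: "k \<in> K" "0 < s" "s \<le> d k" for k s
    using sgn_p[OF k] p_nz(1)[OF k] by (auto simp: sgn_eq field_simps)
  define a where "a k = norm (p k (d k))" for k
  have a: "0 < a k" "a k < 1" if "k \<in> K" for k
    using p_nz(1)[OF that d(1)[OF that]] gp(2)[OF that] d(1)[OF that] unfolding a_def by auto
  have reach: "\<exists>s. 0 < s \<and> s \<le> d k \<and> g (of_real r * \<phi> k) = c k s" if k: "k \<in> K" "0 < r" "r \<le> a k" for k r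
  proof -
    have "\<exists>s\<ge>0. s \<le> d k \<and> norm (p k s) = r"
      using k p0[OF k(1)] d(1)[OF k(1)]
      by (intro IVT') (auto simp: a_def intro!: continuous_on_norm p_cont)
    then obtain s where s: "0 \<le> s" "s \<le> d k" "norm (p k s) = r" by blast
    then have "s \<noteq> 0" using p0[OF k(1)] k by auto
    then have "g (of_real r * \<phi> k) = c k s" using p_eq[of k s] gp(1)[of k s] s k(1) by auto
    then show ?thesis using s \<open>s \<noteq> 0\<close> by (intro exI[of _ s]) auto
  qed
  have "inj_on \<phi> K"
  proof (rule inj_onI)
    fix k k' assume k: "k \<in> K" "k' \<in> K" "\<phi> k = \<phi> k'"
    let ?r = "min (a k) (a k')"
    obtain s s' where "0 < s" "s \<le> d k" "0 < s'" "s' \<le> d k'" "c k s = c k' s'"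
      using reach[of k ?r] reach[of k' ?r] k a by (metis min.cobounded1 min.cobounded2 min_less_iff_conj)
    then show "k = k'" using disj[of k k' s s'] k d(2) by force
  qed
  moreover have "\<phi> ` K = D"
  proof (intro equalityI subsetI)
    fix w assume "w \<in> \<phi> ` K"
    then show "w \<in> D" using p_nz(2) d(1) unfolding \<phi>_def by auto
  next
    fix w assume w: "w \<in> D"
    \<comment> \<open>The parts of the curves far from the centre are removed from the neighbourhood.\<close>
    define F where "F = (\<Union>k\<in>K. c k ` {d k..1})"
    have "closedin X F" unfolding F_def
    proof (intro closedin_Union finite_imageI assms(2), safe)
      fix k assume k: "k \<in> K"
      have "compactin (top_of_set {0..1}) {d k..1}"
        using d(1)[OF k] by (auto simp: compactin_subtopology)
      then have "compactin X (c k ` {d k..1})" using image_compactin cont[OF k] by blast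
      then show "closedin X (c k ` {d k..1})" using assms(1) compactin_imp_closedin by blast
    qed
    then have "openin X (V \<inter> U - F)" using V U_open by blast
    then have "open {z. norm z < 1 \<and> g z \<in> V \<inter> U - F}" by (rule open_preimage_g)
    moreover have "x \<notin> F" using leave d(1) unfolding F_def by (auto simp: image_iff) (metis less_le_trans)
    then have "0 \<in> {z. norm z < 1 \<and> g z \<in> V \<inter> U - F}"
      using g_0 V xU by simp
    ultimately obtain b where b: "b > 0" "ball 0 b \<subseteq> {z. norm z < 1 \<and> g z \<in> V \<inter> U - F}"
      using open_contains_ball by meson
    define r where "r = min b 1 / 2"
    have r: "0 < r" "r < 1" "r < b" using b(1) unfolding r_def by auto
    have w1: "norm w = 1" using w D_sphere by auto
    let ?z = "of_real r * w"
    have z: "norm ?z < 1" "?z \<noteq> 0" "sgn ?z = w" "?z \<in> ball 0 b"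
      using w1 r by (auto simp: norm_mult sgn_mult sgn_eq[of w] sgn_of_real)
    then have "g ?z \<in> V" "g ?z \<in> Y" "g ?z \<noteq> x" "g ?z \<notin> F" 
      using b(2) g_mem_iff[OF z(1)] w h_g[OF z(1)] hx by auto
    then obtain k s where k: "k \<in> K" "0 < s" "s \<le> 1" "g ?z = c k s" "c k s \<notin> F" using cover by metis
    then have "s \<notin> {d k..1}" unfolding F_def by blast
    then have "s < d k" using k by simp
    then have "\<phi> k = sgn (p k s)" using sgn_p[of k s] k by simp
    also have "p k s = ?z" unfolding p_def using h_g[OF z(1)] k(4) by simp
    finally have "w = \<phi> k" using z(3) by simp
    then show "w \<in> \<phi> ` K" using k(1) by blast
  qed
  ultimately have "bij_betw \<phi> K D" unfolding bij_betw_def by blast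
  moreover have "\<exists>r s. 0 < r \<and> r < 1 \<and> 0 < s \<and> s \<le> 1 \<and> g (of_real r * \<phi> k) = c k s" if k: "k \<in> K" for k
    using reach[OF k a(1)[OF k] order_refl] a[OF k] d(2)[OF k]  by force
  ultimately show ?thesis using that by blast
qed

end

section \<open>Edges and faces of an embedded graph\<close>

locale embedded_surface_graph =
  fixes G :: "('a, 'e) surface_graph"
  assumes locally_connected_surf: "locally_connected_space (surf G)"
    and Hausdorff_surf: "Hausdorff_space (surf G)"
    and compact_surf: "compact_space (surf G)"
    and connected_surf: "connected_space (surf G)"
    and nonempty_surf: "topspace (surf G) \<noteq> {}"
    and embedded: "embedded_graph G"
begin

lemma finite_verts: "finite (verts G)" and verts_subset: "verts G \<subseteq> topspace (surf G)"
  and finite_edges: "finite (edges G)"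
  and locally_star: "x \<in> graph_image G \<Longrightarrow> locally_star G x"
  using embedded unfolding embedded_graph_def by auto

lemma continuous_param: "e \<in> edges G \<Longrightarrow> continuous_map (top_of_set {0..1}) (surf G) (param G e)"
  and param_ends: "e \<in> edges G \<Longrightarrow> param G e 0 \<in> verts G" "e \<in> edges G \<Longrightarrow> param G e 1 \<in> verts G"
  using embedded unfolding embedded_graph_def pathin_def by auto

lemma param_not_vertex: "e \<in> edges G \<Longrightarrow> 0 < s \<Longrightarrow> s < 1 \<Longrightarrow> param G e s \<notin> verts G"
  using embedded unfolding embedded_graph_def open_edge_def by fastforce

lemma param_inj:
  assumes "e \<in> edges G" "e' \<in> edges G" "0 < s" "s < 1" "0 < s'" "s' < 1" "param G e s = param G e' s'"
  shows "e = e'" "s = s'"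
proof -
  have "param G e s \<in> open_edge G e" "param G e' s' \<in> open_edge G e'"
    using assms(3-6) unfolding open_edge_def by (intro imageI; simp)+
  moreover have "disjoint_family_on (open_edge G) (edges G)"
    using embedded unfolding embedded_graph_def by blast
  ultimately show "e = e'" using assms(1,2,7) unfolding disjoint_family_on_def by auto
  moreover have "inj_on (param G e) {0<..<1}"
    using embedded assms(1) unfolding embedded_graph_def by blast
  ultimately show "s = s'" using assms unfolding inj_on_def by simp
qed

lemma param_topspace: "e \<in> edges G \<Longrightarrow> 0 \<le> s \<Longrightarrow> s \<le> 1 \<Longrightarrow> param G e s \<in> topspace (surf G)"
  using continuous_param[of e] unfolding continuous_map_def by auto

lemma param_graph: "e \<in> edges G \<Longrightarrow> 0 \<le> s \<Longrightarrow> s \<le> 1 \<Longrightarrow> param G e s \<in> graph_image G"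
  unfolding graph_image_def support_def closed_edge_def by (intro UnI2 UN_I[of e] imageI) auto

lemma closedin_param_image:
  assumes "e \<in> edges G" "0 \<le> a" "b \<le> 1"
  shows "closedin (surf G) (param G e ` {a..b})"
proof -
  have "compactin (top_of_set {0..1}) {a..b}"
    using assms by (auto simp: compactin_subtopology)
  then have "compactin (surf G) (param G e ` {a..b})"
    using image_compactin continuous_param assms(1) by blast
  then show ?thesis using Hausdorff_surf compactin_imp_closedin by blast
qed

lemma closedin_support: "P \<subseteq> edges G \<Longrightarrow> closedin (surf G) (support G P)"
  unfolding support_def closed_edge_def
  by (intro closedin_Union finite_imageI finite_subset[OF _ finite_edges])
    (auto intro!: closedin_param_image)

lemma closedin_verts: "A \<subseteq> verts G \<Longrightarrow> closedin (surf G) A"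
  using finite_verts verts_subset Hausdorff_surf
  by (meson closedin_Hausdorff_finite finite_subset subset_trans)

lemma closedin_graph: "closedin (surf G) (graph_image G)"
  unfolding graph_image_def using closedin_verts closedin_support by blast

lemma graph_cases:
  assumes "y \<in> graph_image G"
  obtains "y \<in> verts G" | e s where "e \<in> edges G" "0 < s" "s < 1" "y = param G e s"
proof -
  have "y \<in> verts G \<or> (\<exists>e\<in>edges G. \<exists>s. 0 < s \<and> s < 1 \<and> y = param G e s)"
  proof (cases "y \<in> verts G")
    case False
    then obtain e s where es: "e \<in> edges G" "0 \<le> s" "s \<le> 1" "y = param G e s"
      using assms unfolding graph_image_def support_def closed_edge_def by auto
    then have "s \<noteq> 0" "s \<noteq> 1" using False param_ends[OF es(1)] by auto
    then show ?thesis using es by (intro disjI2 bexI[of _ e] exI[of _ s]) auto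
  qed simp
  then show ?thesis using that by blast
qed

sublocale cut_space "surf G" "graph_image G"
  by unfold_locales (rule locally_connected_surf closedin_graph)+

lemma faces_eq: "faces G = comps"
  unfolding faces_def comps_def ..

lemma ex_star_chart:
  assumes "x \<in> graph_image G"
  obtains U h g D where "star_chart (surf G) (graph_image G) U h g D x"
proof -
  obtain U h D where 1: "openin (surf G) U" "x \<in> U"
        "homeomorphic_map (subtopology (surf G) U) (top_of_set (ball (0::complex) 1)) h" "h x = 0"
        "finite D" "D \<subseteq> sphere 0 1"
        "h ` (U \<inter> graph_image G) = insert 0 {of_real t * w | t w. w \<in> D \<and> 0 \<le> t \<and> t < 1}"
    using locally_star[OF assms] unfolding locally_star_def by blast
  obtain g where "homeomorphic_maps (subtopology (surf G) U) (top_of_set (ball (0::complex) 1)) h g"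
    using 1(3) homeomorphic_map_maps by blast
  then have "star_chart (surf G) (graph_image G) U h g D x"
    using 1 by unfold_locales
  then show ?thesis using that by blast
qed

text \<open>A loop has two half-edges at its vertex, as required by \<^const>\<open>degree_in\<close>.
  The boolean tells which end of the edge is meant.\<close>

definition half_edges :: "'a \<Rightarrow> ('e \<times> bool) set" where
  "half_edges v = {(e, b). e \<in> edges G \<and> param G e (if b then 1 else 0) = v}"

lemma finite_half_edges: "finite (half_edges v)"
  using finite_edges by (rule finite_subset[OF _ finite_cartesian_product[of "edges G" UNIV], rotated])
    (auto simp: half_edges_def)

lemma degree_half_edges:
  assumes "Q \<subseteq> edges G"
  shows "degree_in G Q v = card {k \<in> half_edges v. fst k \<in> Q}"
proof -
  let ?A = "{e \<in> Q. param G e 0 = v}" and ?B = "{e \<in> Q. param G e 1 = v}"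
  have "{k \<in> half_edges v. fst k \<in> Q} = ((\<lambda>e. (e, False)) ` ?A) \<union> ((\<lambda>e. (e, True)) ` ?B)"
    using assms unfolding half_edges_def by auto
  moreover have "finite ?A" "finite ?B" using finite_subset[OF assms finite_edges] by auto
  ultimately show ?thesis unfolding degree_in_def
    by (simp add: card_Un_disjoint card_image inj_on_def disjoint_iff image_iff)
qed

text \<open>The half-edges are parametrised by the first and the last third of each edge, so that the
  two half-edges of a loop are disjoint.\<close>

lemma vertex_rays:
  assumes "star_chart (surf G) (graph_image G) U h g D v" and v: "v \<in> verts G"
  obtains \<phi> where "bij_betw \<phi> (half_edges v) D"
    "\<And>k. k \<in> half_edges v \<Longrightarrow>
       \<exists>r s. 0 < r \<and> r < 1 \<and> 0 < s \<and> s < 1 \<and> g (of_real r * \<phi> k) = param G (fst k) s"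
proof -
  interpret S: star_chart "surf G" "graph_image G" U h g D v by fact
  define pos where "pos b s = (if b then 1 - s / 3 else s / 3)" for b and s :: real
  define c where "c k s = param G (fst k) (pos (snd k) s)" for k s
  have pos: "0 < pos b s" "pos b s < 1" if "0 < s" "s \<le> 1" for b s
    using that unfolding pos_def by auto
  have K: "e \<in> edges G" "param G e (pos b 0) = v" if "(e, b) \<in> half_edges v" for e b
    using that unfolding half_edges_def pos_def by (auto split: if_splits)
  \<comment> \<open>The complement of \<open>F\<close> is a neighbourhood of \<open>v\<close> where only the half-edges at \<open>v\<close> are left of the graph.\<close>
  define F where "F = (verts G - {v}) \<union> (\<Union>e\<in>edges G. param G e ` {1/3..2/3}) \<union>
     (\<Union>e\<in>{e\<in>edges G. param G e 0 \<noteq> v}. param G e ` {0..1/3}) \<union>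
     (\<Union>e\<in>{e\<in>edges G. param G e 1 \<noteq> v}. param G e ` {2/3..1})"
  have "closedin (surf G) F" unfolding F_def
    using finite_edges closedin_verts
    by (intro closedin_Un closedin_Union) (auto intro!: closedin_param_image)
  then have Vopen: "openin (surf G) (topspace (surf G) - F)" by blast
  have v_off: "param G e s \<noteq> v" if "e \<in> edges G" "0 < s" "s < 1" for e s
    using param_not_vertex[OF that] v by auto
  have "v \<notin> F"
  proof
    assume "v \<in> F"
    then consider e s where "e \<in> edges G" "1/3 \<le> s" "s \<le> 2/3" "v = param G e s"
      | e s where "e \<in> edges G" "0 \<le> s" "s \<le> 1/3" "v = param G e s" "param G e 0 \<noteq> v"
      | e s where "e \<in> edges G" "2/3 \<le> s" "s \<le> 1" "v = param G e s" "param G e 1 \<noteq> v"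
      unfolding F_def by auto
    then show False
    proof cases
      case (1 e s) then show ?thesis using v_off[of e s] by auto
    next
      case (2 e s) then show ?thesis using v_off[of e s] by (cases "s = 0") auto
    next
      case (3 e s) then show ?thesis using v_off[of e s] by (cases "s = 1") auto
    qed
  qed
  show ?thesis
  proof (rule S.germs_rays[of "half_edges v" c "topspace (surf G) - F"])
    show "Hausdorff_space (surf G)" "finite (half_edges v)" by (fact Hausdorff_surf finite_half_edges)+
    show "openin (surf G) (topspace (surf G) - F)" by fact
    show "v \<in> topspace (surf G) - F" using \<open>v \<notin> F\<close> v verts_subset by auto
  next
    fix k assume k: "k \<in> half_edges v"
    obtain e b where [simp]: "k = (e, b)" by force
    have "continuous_map (top_of_set {0..1}) (top_of_set {0..1}) (pos b)"
      unfolding pos_def by (auto intro!: continuous_intros)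
    then have "continuous_map (top_of_set {0..1}) (surf G) (param G e \<circ> pos b)"
      using continuous_param[of e] K(1)[of e b] k by (intro continuous_map_compose) auto
    then show "continuous_map (top_of_set {0..1}) (surf G) (c k)"
      unfolding c_def o_def by simp
    show "c k 0 = v" using K(2)[of e b] k unfolding c_def by simp
  next
    fix k and s :: real assume k: "k \<in> half_edges v" "0 < s" "s \<le> 1"
    then have e: "fst k \<in> edges G" using K(1)[of "fst k" "snd k"] by simp
    show "c k s \<noteq> v" unfolding c_def using v_off[OF e] pos k by simp
    show "c k s \<in> graph_image G" unfolding c_def using param_graph[OF e] pos[of s "snd k"] k by simp
  next
    fix k k' and s s' :: real
    assume k: "k \<in> half_edges v" "k' \<in> half_edges v" "0 < s" "s \<le> 1" "0 < s'" "s' \<le> 1" "c k s = c k' s'"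
    have e: "fst k \<in> edges G" "fst k' \<in> edges G"
      using K(1)[of "fst k" "snd k"] K(1)[of "fst k'" "snd k'"] k by auto
    have "fst k = fst k' \<and> pos (snd k) s = pos (snd k') s'"
      using param_inj[OF e pos[of s "snd k"] pos[of s' "snd k'"]] k unfolding c_def by auto
    then show "k = k'" using k(3-6) unfolding pos_def
      by (auto simp: prod_eq_iff split: if_splits)
  next
    fix y assume y: "y \<in> topspace (surf G) - F" "y \<in> graph_image G" "y \<noteq> v"
    then have "y \<notin> verts G" unfolding F_def by blast
    with y(2) obtain e s where es: "e \<in> edges G" "0 < s" "s < 1" "y = param G e s"
      by (elim graph_cases) auto
    have "s < 1/3 \<or> s > 2/3"
      using y(1) es unfolding F_def by (auto simp: not_le[symmetric])
    then show "\<exists>k\<in>half_edges v. \<exists>s. 0 < s \<and> s \<le> 1 \<and> y = c k s"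
    proof
      assume s: "s < 1/3"
      then have "param G e 0 = v" using y(1) es unfolding F_def by auto
      then have "(e, False) \<in> half_edges v" using es unfolding half_edges_def by simp
      moreover have "y = c (e, False) (3 * s)" using es unfolding c_def pos_def by simp
      ultimately show ?thesis using es s by (intro bexI[of _ "(e, False)"] exI[of _ "3 * s"]) auto
    next
      assume s: "s > 2/3"
      then have "param G e 1 = v" using y(1) es unfolding F_def by auto
      then have "(e, True) \<in> half_edges v" using es unfolding half_edges_def by simp
      moreover have "1 - 3 * (1 - s) / 3 = s" by (simp add: field_simps)
      then have "y = c (e, True) (3 * (1 - s))" using es unfolding c_def pos_def by simp
      ultimately show ?thesis using es s by (intro bexI[of _ "(e, True)"] exI[of _ "3 * (1 - s)"]) auto
    qed
  next
    fix \<phi> assume \<phi>: "bij_betw \<phi> (half_edges v) D"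
      "\<And>k. k \<in> half_edges v \<Longrightarrow> \<exists>r s. 0 < r \<and> r < 1 \<and> 0 < s \<and> s \<le> 1 \<and> g (of_real r * \<phi> k) = c k s"
    show ?thesis
    proof (rule that[OF \<phi>(1)])
      fix k assume "k \<in> half_edges v"
      then obtain r s where "0 < r" "r < 1" "0 < s" "s \<le> 1" "g (of_real r * \<phi> k) = c k s"
        using \<phi>(2) by blast
      then show "\<exists>r s. 0 < r \<and> r < 1 \<and> 0 < s \<and> s < 1 \<and> g (of_real r * \<phi> k) = param G (fst k) s"
        using pos[of s "snd k"] unfolding c_def by blast
    qed
  qed
qed

text \<open>An inner point of an edge cuts it into two curves, hence there are two radii.\<close>

lemma edge_rays:
  assumes "star_chart (surf G) (graph_image G) U h g D (param G e t)"
    and e: "e \<in> edges G" and t: "0 < t" "t < 1"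
  shows "card D = 2"
    "\<And>w. w \<in> D \<Longrightarrow> \<exists>r s. 0 < r \<and> r < 1 \<and> 0 < s \<and> s < 1 \<and> g (of_real r * w) = param G e s"
proof -
  let ?x = "param G e t"
  interpret S: star_chart "surf G" "graph_image G" U h g D ?x by fact
  define c where "c b s = param G e (if b then t + s * ((1 - t) / 2) else t - s * (t / 2))" for b and s :: real
  define pos where "pos b s = (if b then t + s * ((1 - t) / 2) else t - s * (t / 2))" for b and s :: real
  have c_pos: "c b s = param G e (pos b s)" for b s unfolding c_def pos_def by simp
  have pos: "0 < pos b s" "pos b s < 1" if "0 \<le> s" "s \<le> 1" for b s
  proof -
    define p q where "p = s * (t / 2)" and "q = s * ((1 - t) / 2)"
    have "p \<le> 1 * (t / 2)" "q \<le> 1 * ((1 - t) / 2)"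
      unfolding p_def q_def using that t by (intro mult_right_mono; simp)+
    moreover have "0 \<le> p" "0 \<le> q" unfolding p_def q_def using that t by auto
    ultimately have "0 < t + q" "t + q < 1" "0 < t - p" "t - p < 1" using t by auto
    then show "0 < pos b s" "pos b s < 1" unfolding pos_def p_def q_def by (simp_all split: if_split)
  qed
  have pos_sgn: "if b then pos b s > t else pos b s < t" if "0 < s" for b s
    using that t unfolding pos_def by auto
  define F where "F = verts G \<union> (\<Union>e'\<in>edges G - {e}. param G e' ` {0..1}) \<union>
     param G e ` {0..t/2} \<union> param G e ` {(1+t)/2..1}"
  have "closedin (surf G) F" unfolding F_def
    using finite_edges closedin_verts e t
    by (intro closedin_Un closedin_Union) (auto intro!: closedin_param_image)
  then have Vopen: "openin (surf G) (topspace (surf G) - F)" by blast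
  have x_off: "e' = e \<and> s = t" if "e' \<in> edges G" "0 \<le> s" "s \<le> 1" "param G e' s = ?x" for e' s
  proof -
    have "s \<noteq> 0" "s \<noteq> 1" using param_ends[OF that(1)] param_not_vertex[OF e t] that by auto
    then show ?thesis using param_inj[OF that(1) e _ _ t that(4)] that(2,3) by simp
  qed
  have "?x \<notin> F"
  proof
    assume "?x \<in> F"
    then consider "?x \<in> verts G"
      | e' s where "e' \<in> edges G" "e' \<noteq> e" "0 \<le> s" "s \<le> 1" "?x = param G e' s"
      | s where "0 \<le> s" "s \<le> t/2" "?x = param G e s"
      | s where "(1+t)/2 \<le> s" "s \<le> 1" "?x = param G e s"
      unfolding F_def by fastforce
    then show False
    proof cases
      case 1 then show ?thesis using param_not_vertex[OF e t] by simp
    next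
      case (2 e' s) then show ?thesis using x_off[of e' s] by auto
    next
      case (3 s) then show ?thesis using x_off[of e s] e t by auto
    next
      case (4 s) then show ?thesis using x_off[of e s] e t by auto
    qed
  qed
  obtain \<phi> where \<phi>: "bij_betw \<phi> (UNIV :: bool set) D"
      "\<And>k. k \<in> UNIV \<Longrightarrow> \<exists>r s. 0 < r \<and> r < 1 \<and> 0 < s \<and> s \<le> 1 \<and> g (of_real r * \<phi> k) = c k s"
  proof (rule S.germs_rays[of "UNIV :: bool set" c "topspace (surf G) - F"])
    show "Hausdorff_space (surf G)" "finite (UNIV :: bool set)" by (simp_all add: Hausdorff_surf)
    show "openin (surf G) (topspace (surf G) - F)" by fact
    show "?x \<in> topspace (surf G) - F" using \<open>?x \<notin> F\<close> param_topspace[OF e] t by auto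
  next
    fix b :: bool
    have "continuous_map (top_of_set {0..1}) (top_of_set {0..1}) (pos b)"
    proof -
      have "continuous_on {0..1} (pos b)"
        unfolding pos_def by (cases b) (auto intro!: continuous_intros)
      then show ?thesis using pos[of _ b] by (auto simp: less_imp_le)
    qed
    then have "continuous_map (top_of_set {0..1}) (surf G) (param G e \<circ> pos b)"
      using continuous_param[OF e] by (rule continuous_map_compose)
    then show "continuous_map (top_of_set {0..1}) (surf G) (c b)"
      by (simp add: o_def flip: c_pos)
    show "c b 0 = ?x" unfolding c_def by simp
  next
    fix b :: bool and s :: real assume s: "0 < s" "s \<le> 1"
    show "c b s \<noteq> ?x" using x_off[OF e, of "pos b s"] pos[of s b] s pos_sgn[OF s(1), of b]
      unfolding c_pos by (auto split: if_splits)
    show "c b s \<in> graph_image G" unfolding c_pos using param_graph[OF e] pos[of s b] s by simp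
  next
    fix k k' :: bool and s s' :: real
    assume k: "0 < s" "s \<le> 1" "0 < s'" "s' \<le> 1" "c k s = c k' s'"
    have "pos k s = pos k' s'"
      using param_inj(2)[OF e e, of "pos k s" "pos k' s'"] pos[of s k] pos[of s' k'] k unfolding c_pos by auto
    then show "k = k'" using pos_sgn[OF k(1), of k] pos_sgn[OF k(3), of k'] by (auto split: if_splits)
  next
    fix y assume y: "y \<in> topspace (surf G) - F" "y \<in> graph_image G" "y \<noteq> ?x"
    then have "y \<notin> verts G" unfolding F_def by blast
    with y(2) obtain e' s where es: "e' \<in> edges G" "0 < s" "s < 1" "y = param G e' s"
      by (elim graph_cases) auto
    have "y \<in> param G e' ` {0..1}" using es by auto
    then have [simp]: "e' = e" using y(1) es(1) unfolding F_def by blast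
    have "y \<notin> param G e ` {0..t/2}" "y \<notin> param G e ` {(1+t)/2..1}"
      using y(1) unfolding F_def by blast+
    then have "s \<notin> {0..t/2}" "s \<notin> {(1+t)/2..1}" using es(4) by auto
    moreover have "s \<noteq> t" using y(3) es(4) by auto
    ultimately have s: "t/2 < s" "s < (1+t)/2" "s \<noteq> t" using es by auto
    show "\<exists>k\<in>UNIV. \<exists>s. 0 < s \<and> s \<le> 1 \<and> y = c k s"
    proof (cases "s < t")
      case True
      have "pos False ((t - s) / (t / 2)) = s" using t unfolding pos_def by (simp add: field_simps)
      then have "y = c False ((t - s) / (t / 2))" using es unfolding c_pos by simp
      then show ?thesis using True s t by (intro bexI[of _ False] exI[of _ "(t - s) / (t / 2)"]) auto
    next
      case False
      have "pos True ((s - t) / ((1 - t) / 2)) = s" using t unfolding pos_def by (simp add: field_simps)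
      then have "y = c True ((s - t) / ((1 - t) / 2))" using es unfolding c_pos by simp
      then show ?thesis using False s t
        by (intro bexI[of _ True] exI[of _ "(s - t) / ((1 - t) / 2)"]) (auto simp: field_simps)
    qed
  qed blast
  show "card D = 2" using bij_betw_same_card[OF \<phi>(1)] by simp
  fix w assume "w \<in> D"
  then obtain b where b: "w = \<phi> b" using \<phi>(1) unfolding bij_betw_def by blast
  obtain r s where "0 < r" "r < 1" "0 < s" "s \<le> 1" "g (of_real r * \<phi> b) = c b s"
    using \<phi>(2) by blast
  then show "\<exists>r s. 0 < r \<and> r < 1 \<and> 0 < s \<and> s < 1 \<and> g (of_real r * w) = param G e s"
    using pos[of s b] unfolding c_pos b by (intro exI[of _ r] exI[of _ "pos b s"]) auto
qed

text \<open>Both the edge and the adherent faces are seen in the chart of one inner point, where the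
  star has two radii; so the adherent faces are locally constant on the edge, which is connected.\<close>

lemma adherent_along_edge:
  assumes e: "e \<in> edges G" and s: "0 < s" "s < 1" "0 < t" "t < 1"
  shows "adherent (param G e s) = adherent (param G e t)"
proof -
  have "(\<lambda>s. adherent (param G e s)) constant_on {0<..<1::real}"
  proof (rule locally_constant_imp_constant)
    show "connected {0<..<1::real}" by simp
    fix a :: real assume a: "a \<in> {0<..<1}"
    have "param G e a \<in> graph_image G" using param_graph[OF e] a by simp
    then obtain U h g D where st: "star_chart (surf G) (graph_image G) U h g D (param G e a)"
      using ex_star_chart by blast
    interpret S: star_chart "surf G" "graph_image G" U h g D "param G e a" by fact
    have D2: "card D \<le> 2" using edge_rays(1)[OF st e] a by simp
    have "openin (top_of_set {0..1}) {s \<in> topspace (top_of_set {0..1}). param G e s \<in> U}"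
      using continuous_param[OF e] S.U_open unfolding continuous_map_def by blast
    then obtain O' where O': "open O'" "{s \<in> {0..1}. param G e s \<in> U} = {0..1} \<inter> O'"
      unfolding openin_open by auto
    have "adherent (param G e s) = adherent (param G e a)" if "s \<in> {0<..<1} \<inter> O'" for s
    proof (rule S.adherent_two_rays[OF D2])
      have "s \<in> {0..1} \<inter> O'" using that by auto
      then show "param G e s \<in> U" using O'(2) by blast
      show "param G e s \<in> graph_image G" using param_graph[OF e] that by simp
    qed
    moreover have "a \<in> {0..1} \<inter> O'" unfolding O'(2)[symmetric] using a S.xU by auto
    ultimately show "\<exists>T. openin (top_of_set {0<..<1}) T \<and> a \<in> T \<and>
        (\<forall>s\<in>T. adherent (param G e s) = adherent (param G e a))"
      using openin_open_Int[OF O'(1), of "{0<..<1}"] a by (intro exI[of _ "{0<..<1} \<inter> O'"]) blast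
  qed
  then show ?thesis using s unfolding constant_on_def by auto
qed

lemma dual_ends_eq:
  assumes e: "e \<in> edges G" and s: "0 < s" "s < 1"
  shows "dual_ends G e = adherent (param G e s)"
proof -
  have "open_edge G e \<subseteq> surf G closure_of f \<longleftrightarrow> f \<in> adherent (param G e s)" if f: "f \<in> comps" for f
  proof -
    have "f \<in> adherent (param G e t) \<longleftrightarrow> f \<in> adherent (param G e s)" if "0 < t" "t < 1" for t
      using adherent_along_edge[OF e that s] by simp
    then have "(\<forall>t\<in>{0<..<1}. f \<in> adherent (param G e t)) \<longleftrightarrow> f \<in> adherent (param G e s)"
      using s by (metis greaterThanLessThan_iff)
    moreover have "open_edge G e \<subseteq> surf G closure_of f \<longleftrightarrow> (\<forall>t\<in>{0<..<1}. f \<in> adherent (param G e t))"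
      using f unfolding adherent_def open_edge_def by blast
    ultimately show ?thesis by blast
  qed
  then show ?thesis unfolding dual_ends_def faces_eq adherent_def by blast
qed

lemma dual_ends_ray:
  assumes "star_chart (surf G) (graph_image G) U h g D x" and t: "cis t \<in> D"
    and eps: "0 < \<epsilon>" "\<And>s. s \<noteq> t \<Longrightarrow> \<bar>s - t\<bar> \<le> \<epsilon> \<Longrightarrow> cis s \<notin> D"
    and r: "0 < r" "r < 1" and e: "e \<in> edges G" "0 < s" "s < 1"
    and "g (of_real r * cis t) = param G e s"
  shows "dual_ends G e = {star_chart.side (surf G) (graph_image G) g (t - \<epsilon>),
                          star_chart.side (surf G) (graph_image G) g (t + \<epsilon>)}"
proof -
  interpret S: star_chart "surf G" "graph_image G" U h g D x by fact
  show ?thesis using S.adherent_ray[OF t eps r] dual_ends_eq[OF e] assms(10) by (simp add: rcis_def)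
qed

lemma dual_ends_two:
  assumes "e \<in> edges G"
  obtains L R where "L \<in> faces G" "R \<in> faces G" "dual_ends G e = {L, R}"
proof -
  have "param G e (1/2) \<in> graph_image G" using param_graph[OF assms] by simp
  then obtain U h g D where st: "star_chart (surf G) (graph_image G) U h g D (param G e (1/2))"
    using ex_star_chart by blast
  interpret S: star_chart "surf G" "graph_image G" U h g D "param G e (1/2)" by fact
  have D2: "card D = 2" using edge_rays(1)[OF st assms] by simp
  then obtain w where w: "w \<in> D" by fastforce
  obtain t where t: "cis t = w" using S.cis_angle[OF w] by blast
  have tD: "cis t \<in> D" using t w by simp
  obtain \<epsilon> where e: "0 < \<epsilon>" "\<epsilon> < pi" "\<And>s. s \<noteq> t \<Longrightarrow> \<bar>s - t\<bar> \<le> \<epsilon> \<Longrightarrow> cis s \<notin> D"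
    using ex_isolating[OF S.finite_D] by blast
  have "dual_ends G e = {S.side (t - \<epsilon>), S.side (t + \<epsilon>)}"
    using dual_ends_eq[OF assms, of "1/2"] S.adherent_centre S.sides_two_rays[OF _ tD e] D2 by simp
  moreover have "cis (t - \<epsilon>) \<notin> D" "cis (t + \<epsilon>) \<notin> D" using e by (auto intro!: e(3))
  ultimately show ?thesis using that S.side_in_comps unfolding faces_eq by blast
qed

text \<open>If \<open>L = R\<close>, the edge is not on the boundary of its face, and it has no side of
  different status either.\<close>

lemma mem_boundary2_iff:
  assumes "e \<in> edges G" "dual_ends G e = {L, R}"
  shows "e \<in> boundary2 G S A \<longleftrightarrow> e \<in> edges_in G S \<and> (L \<in> A) \<noteq> (R \<in> A)"
proof -
  have "{f \<in> A. e \<in> face_boundary G f} = (if L = R then {} else A \<inter> {L, R})"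
    using assms unfolding face_boundary_def by auto
  then show ?thesis unfolding boundary2_def by (cases "L \<in> A"; cases "R \<in> A") (auto simp: Int_insert_right)
qed

lemma edges_in_topspace: "edges_in G (topspace (surf G)) = edges G"
  using param_topspace unfolding edges_in_def open_edge_def by auto

lemma verts_in_topspace: "verts_in G (topspace (surf G)) = verts G"
  using verts_subset unfolding verts_in_def by auto

lemma faces_in_topspace: "faces_in G (topspace (surf G)) = faces G"
  using comps_subset unfolding faces_in_def faces_eq by auto

text \<open>The boundary of a boundary vanishes modulo 2: at a vertex, the half-edges in the boundary of
  \<open>A\<close> are the radii where the status of the face changes during a full turn.\<close>

lemma boundary_is_polygon: "boundary2 G (topspace (surf G)) A \<in> polygons G (topspace (surf G))"
proof -
  let ?B = "boundary2 G (topspace (surf G)) A"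
  have B: "?B \<subseteq> edges G" unfolding boundary2_def edges_in_topspace by auto
  have "even (degree_in G ?B v)" if v: "v \<in> verts G" for v
  proof -
    have "v \<in> graph_image G" using v unfolding graph_image_def by blast
    then obtain U h g D where st: "star_chart (surf G) (graph_image G) U h g D v"
      using ex_star_chart by blast
    interpret S: star_chart "surf G" "graph_image G" U h g D v by fact
    obtain \<phi> where \<phi>: "bij_betw \<phi> (half_edges v) D"
      "\<And>k. k \<in> half_edges v \<Longrightarrow>
         \<exists>r s. 0 < r \<and> r < 1 \<and> 0 < s \<and> s < 1 \<and> g (of_real r * \<phi> k) = param G (fst k) s"
      using vertex_rays[OF st v] by blast
    define J where "J w \<longleftrightarrow> fst (inv_into (half_edges v) \<phi> w) \<in> ?B" for w
    have J\<phi>: "J (\<phi> k) \<longleftrightarrow> fst k \<in> ?B" if "k \<in> half_edges v" for k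
      using \<phi>(1) that unfolding J_def bij_betw_def by simp
    have "even (card {w \<in> D. J w})"
    proof (rule S.even_jumping_rays)
      fix t \<epsilon> assume t: "cis t \<in> D" and \<epsilon>: "0 < \<epsilon>" "\<And>s. s \<noteq> t \<Longrightarrow> \<bar>s - t\<bar> \<le> \<epsilon> \<Longrightarrow> cis s \<notin> D"
      obtain k where k: "k \<in> half_edges v" "cis t = \<phi> k" using \<phi>(1) t unfolding bij_betw_def by auto
      obtain r s where rs: "0 < r" "r < 1" "0 < s" "s < 1" "g (of_real r * cis t) = param G (fst k) s"
        using \<phi>(2)[OF k(1)] k(2) by auto
      have ek: "fst k \<in> edges G" using k(1) unfolding half_edges_def by auto
      have "dual_ends G (fst k) = {S.side (t - \<epsilon>), S.side (t + \<epsilon>)}"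
        using dual_ends_ray[OF st t \<epsilon> rs(1,2) ek rs(3,4,5)] .
      then have "fst k \<in> ?B \<longleftrightarrow> (S.side (t - \<epsilon>) \<in> A) \<noteq> (S.side (t + \<epsilon>) \<in> A)"
        using mem_boundary2_iff[OF ek] ek edges_in_topspace by simp
      then show "J (cis t) \<longleftrightarrow> (S.side (t - \<epsilon>) \<in> A) \<noteq> (S.side (t + \<epsilon>) \<in> A)"
        using J\<phi> k by simp
    qed
    moreover have "bij_betw \<phi> {k \<in> half_edges v. fst k \<in> ?B} {w \<in> D. J w}"
      using \<phi>(1) J\<phi> unfolding bij_betw_def by (auto simp: inj_on_def)
    then have "card {k \<in> half_edges v. fst k \<in> ?B} = card {w \<in> D. J w}" by (rule bij_betw_same_card)
    ultimately show ?thesis using degree_half_edges[OF B] by simp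
  qed
  then show ?thesis using B unfolding polygons_def edges_in_topspace verts_in_topspace by blast
qed

lemma ray_edge:
  assumes st: "star_chart (surf G) (graph_image G) U h g D x" and w: "w \<in> D"
  obtains e r s where "e \<in> edges G" "x \<in> closed_edge G e" "0 < r" "r < 1" "0 < s" "s < 1"
    "g (of_real r * w) = param G e s"
proof -
  interpret S: star_chart "surf G" "graph_image G" U h g D x by fact
  show ?thesis using S.x_mem
  proof (cases rule: graph_cases)
    case 1
    obtain \<phi> where \<phi>: "bij_betw \<phi> (half_edges x) D"
      "\<And>k. k \<in> half_edges x \<Longrightarrow>
         \<exists>r s. 0 < r \<and> r < 1 \<and> 0 < s \<and> s < 1 \<and> g (of_real r * \<phi> k) = param G (fst k) s"
      using vertex_rays[OF st 1] by blast
    obtain k where k: "k \<in> half_edges x" "w = \<phi> k" using \<phi>(1) w unfolding bij_betw_def by auto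
    then have "fst k \<in> edges G" "x = param G (fst k) (if snd k then 1 else 0)"
      unfolding half_edges_def by auto
    moreover have "(if snd k then 1 else 0) \<in> {0..1::real}" by simp
    ultimately have "fst k \<in> edges G" "x \<in> closed_edge G (fst k)" unfolding closed_edge_def by auto
    then show ?thesis using that \<phi>(2)[OF k(1)] k(2) by blast
  next
    case (2 e s)
    then have "x \<in> closed_edge G e" unfolding closed_edge_def by auto
    then show ?thesis using that edge_rays(2)[of U h g D e s w] st w 2 by blast
  qed
qed

text \<open>Near a point of the graph only finitely many directions belong to the graph, and in each of
  the others there is a face adherent to the point.\<close>

lemma open_meets_face:
  assumes "openin (surf G) N" "y \<in> N"
  obtains f where "f \<in> faces G" "f \<inter> N \<noteq> {}"
proof (cases "y \<in> graph_image G")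
  case False
  have "y \<in> topspace (surf G)" using assms openin_subset by blast
  then show ?thesis using that comp_at False assms(2) unfolding faces_eq by blast
next
  case True
  then obtain U h g D where st: "star_chart (surf G) (graph_image G) U h g D y"
    using ex_star_chart by blast
  interpret S: star_chart "surf G" "graph_image G" U h g D y by fact
  obtain \<epsilon> where \<epsilon>: "0 < \<epsilon>" "\<And>s. s \<noteq> 0 \<Longrightarrow> \<bar>s - 0\<bar> \<le> \<epsilon> \<Longrightarrow> cis s \<notin> D"
    using ex_isolating[OF S.finite_D, of 0] by blast
  then have "cis \<epsilon> \<notin> D" by (intro \<epsilon>(2)) auto
  then have "S.side \<epsilon> \<in> adherent y" using S.adherent_centre by blast
  then show ?thesis using that assms unfolding adherent_def faces_eq in_closure_of by blast
qed

text \<open>By compactness it is enough that every point has a neighbourhood meeting finitely many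
  faces.\<close>

lemma finite_faces: "finite (faces G)"
proof -
  let ?C = "{N. openin (surf G) N \<and> finite {f \<in> faces G. f \<inter> N \<noteq> {}}}"
  have "\<exists>N\<in>?C. y \<in> N" if y: "y \<in> topspace (surf G)" for y
  proof (cases "y \<in> graph_image G")
    case False
    have "{f \<in> faces G. f \<inter> comp_at y \<noteq> {}} \<subseteq> {comp_at y}"
      using comps_disjoint comp_at[OF y False] unfolding faces_eq by blast
    then show ?thesis using comp_at[OF y False] openin_comps finite_subset by blast
  next
    case True
    then obtain U h g D where st: "star_chart (surf G) (graph_image G) U h g D y"
      using ex_star_chart by blast
    interpret S: star_chart "surf G" "graph_image G" U h g D y by fact
    have "{f \<in> faces G. f \<inter> U \<noteq> {}} \<subseteq> S.side ` {t. cis t \<notin> D}"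
      using S.comp_meeting_chart unfolding faces_eq by blast
    then show ?thesis using S.finite_sides finite_subset S.U_open S.xU by blast
  qed
  then have "topspace (surf G) \<subseteq> \<Union>?C" by blast
  then obtain C where C: "finite C" "C \<subseteq> ?C" "topspace (surf G) \<subseteq> \<Union>C"
    using compact_surf unfolding compact_space_alt by (metis (no_types, lifting) mem_Collect_eq)
  have "faces G \<subseteq> (\<Union>N\<in>C. {f \<in> faces G. f \<inter> N \<noteq> {}})"
  proof
    fix f assume f: "f \<in> faces G"
    then have "f \<noteq> {}" "f \<subseteq> topspace (surf G)"
      using nonempty_connected_components_of comps_subset unfolding faces_eq comps_def by blast+
    then show "f \<in> (\<Union>N\<in>C. {f \<in> faces G. f \<inter> N \<noteq> {}})" using C(3) f by blast
  qed
  moreover have "finite (\<Union>N\<in>C. {f \<in> faces G. f \<inter> N \<noteq> {}})" using C(1,2) by blast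
  ultimately show ?thesis by (rule finite_subset)
qed

section \<open>Regions cut out by a set of edges\<close>

lemma cut_space_support: "P \<subseteq> edges G \<Longrightarrow> cut_space (surf G) (support G P)"
  by unfold_locales (use locally_connected_surf closedin_support in auto)

lemma regions_eq: "P \<subseteq> edges G \<Longrightarrow> regions G P = cut_space.comps (surf G) (support G P)"
  unfolding regions_def cut_space.comps_def[OF cut_space_support] ..

lemma support_subset: "P \<subseteq> edges G \<Longrightarrow> support G P \<subseteq> graph_image G"
  unfolding graph_image_def support_def by blast

lemma regions:
  assumes "P \<subseteq> edges G" "S \<in> regions G P"
  shows "openin (surf G) S" "connectedin (surf G) S" "S \<subseteq> topspace (surf G) - support G P" "S \<noteq> {}"
proof -
  interpret R: cut_space "surf G" "support G P" using cut_space_support[OF assms(1)] .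
  have S: "S \<in> R.comps" using assms regions_eq by simp
  show "openin (surf G) S" "connectedin (surf G) S" "S \<subseteq> topspace (surf G) - support G P"
    using S R.openin_comps R.connectedin_comps R.comps_subset by auto
  show "S \<noteq> {}" using S nonempty_connected_components_of unfolding R.comps_def by blast
qed

lemma regions_disjoint:
  assumes "P \<subseteq> edges G" "S \<in> regions G P" "S' \<in> regions G P" "S \<inter> S' \<noteq> {}"
  shows "S = S'"
proof -
  interpret R: cut_space "surf G" "support G P" using cut_space_support[OF assms(1)] .
  show ?thesis using R.comps_disjoint assms regions_eq by blast
qed

lemma connected_in_region:
  assumes P: "P \<subseteq> edges G" and C: "connectedin (surf G) C" "C \<inter> support G P = {}" "C \<noteq> {}"
  obtains S where "S \<in> regions G P" "C \<subseteq> S"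
proof -
  interpret R: cut_space "surf G" "support G P" using cut_space_support[OF P] .
  obtain y where y: "y \<in> C" using C by blast
  then have "y \<in> topspace (surf G)" "y \<notin> support G P" using C connectedin_subset_topspace by blast+
  note y' = R.comp_at[OF this]
  have "C \<subseteq> R.comp_at y" using R.connected_subset_comp[OF C(1,2) y'(1)] y y'(2) by blast
  then show ?thesis using that y'(1) regions_eq[OF P] by blast
qed

lemma connected_subset_region:
  assumes "P \<subseteq> edges G" "connectedin (surf G) C" "C \<inter> support G P = {}" "S \<in> regions G P" "C \<inter> S \<noteq> {}"
  shows "C \<subseteq> S"
proof -
  have "C \<noteq> {}" using assms by blast
  then obtain S' where S': "S' \<in> regions G P" "C \<subseteq> S'" using connected_in_region assms by blast
  then have "S = S'" using assms by (intro regions_disjoint[of P]) auto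
  then show ?thesis using S' by simp
qed

lemma face_props:
  assumes "f \<in> faces G"
  shows "openin (surf G) f" "connectedin (surf G) f" "f \<noteq> {}" "f \<subseteq> topspace (surf G) - graph_image G"
  using assms openin_comps connectedin_comps comps_subset nonempty_connected_components_of
  unfolding faces_eq comps_def by blast+

lemma face_in_region:
  assumes P: "P \<subseteq> edges G" and f: "f \<in> faces G"
  obtains S where "S \<in> regions G P" "f \<subseteq> S"
  using connected_in_region[OF P face_props(2)[OF f] _ face_props(3)[OF f]] face_props(4)[OF f] support_subset[OF P] by blast

lemma face_subset_region:
  assumes P: "P \<subseteq> edges G" and f: "f \<in> faces G" and S: "S \<in> regions G P" "f \<inter> S \<noteq> {}"
  shows "f \<subseteq> S"
  using connected_subset_region[OF P face_props(2)[OF f] _ S] face_props(4)[OF f] support_subset[OF P] by blast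

text \<open>This makes the regions finite in number, and it is why distinct sets of regions contain
  distinct sets of faces.\<close>

lemma region_has_face:
  assumes P: "P \<subseteq> edges G" and S: "S \<in> regions G P"
  obtains f where "f \<in> faces G" "f \<subseteq> S"
proof -
  obtain y where "y \<in> S" using regions(4)[OF P S] by blast
  then obtain f where "f \<in> faces G" "f \<inter> S \<noteq> {}" using open_meets_face regions(1)[OF P S] by blast
  then show ?thesis using that face_subset_region[OF P _ S] by blast
qed

lemma finite_regions:
  assumes P: "P \<subseteq> edges G"
  shows "finite (regions G P)"
proof -
  have "\<forall>S\<in>regions G P. \<exists>f. f \<in> faces G \<and> f \<subseteq> S" using region_has_face[OF P] by blast
  then obtain F where F: "\<And>S. S \<in> regions G P \<Longrightarrow> F S \<in> faces G \<and> F S \<subseteq> S"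
    by (meson bchoice)
  have "inj_on F (regions G P)"
  proof (rule inj_onI)
    fix S S' assume S: "S \<in> regions G P" "S' \<in> regions G P" "F S = F S'"
    then show "S = S'" using F[OF S(1)] F[OF S(2)] face_props(3)[of "F S"]
      by (intro regions_disjoint[OF P S(1,2)]) auto
  qed
  moreover have "F ` regions G P \<subseteq> faces G" using F by blast
  ultimately show ?thesis using finite_faces by (rule inj_on_finite)
qed

lemma connectedin_open_edge:
  assumes "e \<in> edges G"
  shows "connectedin (surf G) (open_edge G e)"
proof -
  have "connectedin (top_of_set {0..1}) {0<..<1::real}" by (auto simp: connectedin_subtopology)
  then show ?thesis unfolding open_edge_def
    using connectedin_continuous_map_image continuous_param[OF assms] by blast
qed

lemma open_edge_nonempty: "open_edge G e \<noteq> {}"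
  unfolding open_edge_def by simp

lemma open_edge_disjoint_support:
  assumes P: "P \<subseteq> edges G" and e: "e \<in> edges G" "e \<notin> P"
  shows "open_edge G e \<inter> support G P = {}"
proof (rule ccontr)
  assume "\<not> ?thesis"
  then obtain y where y: "y \<in> open_edge G e" "y \<in> support G P" by blast
  obtain s where s: "s \<in> {0<..<1}" "y = param G e s" using y(1) unfolding open_edge_def by blast
  obtain e' s' where s': "e' \<in> P" "s' \<in> {0..1}" "y = param G e' s'"
    using y(2) unfolding support_def closed_edge_def by blast
  have *: "0 < s" "s < 1" "e' \<in> P" "0 \<le> s'" "s' \<le> 1" "param G e s = param G e' s'"
    using s s' by auto
  have e': "e' \<in> edges G" "e' \<noteq> e" using s'(1) P e(2) by blast+
  have "param G e' s' \<notin> verts G" using param_not_vertex[OF e(1) *(1,2)] *(6) by simp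
  then have "s' \<noteq> 0" "s' \<noteq> 1" using param_ends[OF e'(1)] by metis+
  then have "0 < s'" "s' < 1" using *(4,5) by auto
  then show False using param_inj(1)[OF e(1) e'(1) *(1,2) _ _ *(6)] e'(2) by simp
qed

lemma edge_in_region:
  assumes P: "P \<subseteq> edges G" and e: "e \<in> edges G" "e \<notin> P"
  obtains S where "S \<in> regions G P" "open_edge G e \<subseteq> S"
  using connected_in_region[OF P connectedin_open_edge[OF e(1)] open_edge_disjoint_support[OF P e] open_edge_nonempty] .

lemma edges_in_region:
  assumes P: "P \<subseteq> edges G" and S: "S \<in> regions G P"
  shows "edges_in G S \<subseteq> edges G - P"
proof
  fix e assume e: "e \<in> edges_in G S"
  have "(1/2 :: real) \<in> {0<..<1}" "(1/2 :: real) \<in> {0..1}" by auto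
  then have "param G e (1/2) \<in> open_edge G e" "e \<in> P \<Longrightarrow> param G e (1/2) \<in> support G P"
    unfolding open_edge_def support_def closed_edge_def by blast+
  then show "e \<in> edges G - P" using e regions(3)[OF P S] unfolding edges_in_def by blast
qed

text \<open>The region that contains the edge is open, so it meets the faces on the sides of the edge;
  these are connected and avoid \<open>P\<close>, so they lie in this region.\<close>

lemma dual_end_region:
  assumes P: "P \<subseteq> edges G" and e: "e \<in> edges G" "e \<notin> P" and f: "f \<in> dual_ends G e" and S: "S \<in> regions G P"
  shows "f \<subseteq> S \<longleftrightarrow> e \<in> edges_in G S"
proof -
  have f': "f \<in> faces G" "open_edge G e \<subseteq> surf G closure_of f" using f unfolding dual_ends_def by auto
  obtain S' where S': "S' \<in> regions G P" "open_edge G e \<subseteq> S'" using edge_in_region[OF P e] .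
  obtain y where y: "y \<in> open_edge G e" using open_edge_nonempty[of e] by blast
  then have "y \<in> S'" "y \<in> surf G closure_of f" using S'(2) f'(2) by auto
  then have "f \<inter> S' \<noteq> {}" using regions(1)[OF P S'(1)] unfolding in_closure_of by blast
  then have "f \<subseteq> S'" using face_subset_region[OF P f'(1) S'(1)] by blast
  then have "f \<subseteq> S \<longleftrightarrow> S = S'"
    using regions_disjoint[OF P S S'(1)] face_props(3)[OF f'(1)] by blast
  moreover have "open_edge G e \<subseteq> S \<longleftrightarrow> S = S'"
    using regions_disjoint[OF P S S'(1)] open_edge_nonempty[of e] S'(2) by blast
  ultimately show ?thesis using e unfolding edges_in_def by simp
qed

lemma edge_at_vertex_in_region:
  assumes P: "P \<subseteq> edges G" and S: "S \<in> regions G P" and v: "v \<in> S"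
    and e: "e \<in> edges G" "a \<in> {0, 1}" "param G e a = v"
  shows "e \<in> edges_in G S"
proof -
  have a: "a \<in> {0..1}" using e by auto
  then have "v \<in> closed_edge G e" using e unfolding closed_edge_def by auto
  then have eP: "e \<notin> P" using regions(3)[OF P S] v unfolding support_def by auto
  let ?T = "{s \<in> {0..1}. param G e s \<in> S}"
  have "openin (top_of_set {0..1}) ?T"
    using continuous_param[OF e(1)] regions(1)[OF P S] unfolding continuous_map_def by simp
  then have "\<forall>s\<in>?T. \<exists>d>0. ball s d \<inter> {0..1} \<subseteq> ?T"
    using openin_contains_ball[of "{0..1}" ?T] by blast
  moreover have "a \<in> ?T" using a e v by simp
  ultimately obtain d where d: "d > 0" "ball a d \<inter> {0..1} \<subseteq> ?T" by blast
  define s where "s = (if a = 0 then min d 1 / 2 else 1 - min d 1 / 2)"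
  have s: "0 < s" "s < 1" "dist a s < d" using d(1) e(2) unfolding s_def by (auto simp: dist_real_def)
  then have "param G e s \<in> S" using d(2) by auto
  moreover have "param G e s \<in> open_edge G e" using s unfolding open_edge_def by auto
  ultimately have "open_edge G e \<subseteq> S"
    using connected_subset_region[OF P connectedin_open_edge[OF e(1)] open_edge_disjoint_support[OF P e(1) eP] S] by blast
  then show ?thesis using e(1) unfolding edges_in_def by simp
qed

text \<open>If \<open>y\<close> is on the graph, every radius of the star around \<open>y\<close> lies
  on an edge whose closure contains \<open>y\<close>. Such an edge is not in \<open>P\<close>, so
  crossing it does not change the status.\<close>

lemma local_status:
  assumes P: "P \<subseteq> edges G" and A: "boundary2 G (topspace (surf G)) A \<subseteq> P"
    and y: "y \<in> topspace (surf G)" "y \<notin> support G P"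
  shows "\<exists>N b. openin (surf G) N \<and> y \<in> N \<and> (\<forall>f\<in>faces G. f \<inter> N \<noteq> {} \<longrightarrow> (f \<in> A \<longleftrightarrow> b))"
proof (cases "y \<in> graph_image G")
  case False
  have "f = comp_at y" if "f \<in> faces G" "f \<inter> comp_at y \<noteq> {}" for f
    using comps_disjoint comp_at[OF y(1) False] that unfolding faces_eq by blast
  then show ?thesis using comp_at[OF y(1) False] openin_comps by blast
next
  case True
  then obtain U h g D where st: "star_chart (surf G) (graph_image G) U h g D y"
    using ex_star_chart by blast
  interpret S: star_chart "surf G" "graph_image G" U h g D y by fact
  have agree: "S.side s \<in> A \<longleftrightarrow> S.side t \<in> A" if "cis s \<notin> D" "cis t \<notin> D" for s t
  proof (rule S.sides_agree[OF _ that])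
    fix t \<epsilon> assume t: "cis t \<in> D" and \<epsilon>: "0 < \<epsilon>" "\<And>s. s \<noteq> t \<Longrightarrow> \<bar>s - t\<bar> \<le> \<epsilon> \<Longrightarrow> cis s \<notin> D"
    obtain e r s where e: "e \<in> edges G" "y \<in> closed_edge G e" "0 < r" "r < 1" "0 < s" "s < 1"
       "g (of_real r * cis t) = param G e s"
      using ray_edge[OF st t] by blast
    have "e \<notin> P" using e(2) y(2) unfolding support_def by blast
    then have "e \<notin> boundary2 G (topspace (surf G)) A" using A by blast
    moreover have "dual_ends G e = {S.side (t - \<epsilon>), S.side (t + \<epsilon>)}"
      using dual_ends_ray[OF st t \<epsilon> e(3,4,1,5,6,7)] .
    ultimately show "(S.side (t - \<epsilon>) \<in> A) = (S.side (t + \<epsilon>) \<in> A)"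
      using mem_boundary2_iff[OF e(1), of _ _ "topspace (surf G)" A] e(1) edges_in_topspace by simp
  qed
  define b where "b \<longleftrightarrow> (\<exists>t. cis t \<notin> D \<and> S.side t \<in> A)"
  have "f \<in> A \<longleftrightarrow> b" if f: "f \<in> faces G" "f \<inter> U \<noteq> {}" for f
  proof -
    obtain z where "z \<in> f" "z \<in> U" using f(2) by blast
    then obtain t where "cis t \<notin> D" "f = S.side t"
      using S.comp_meeting_chart[of f z] f(1) unfolding faces_eq by blast
    then show ?thesis unfolding b_def using agree by blast
  qed
  then show ?thesis using S.U_open S.xU by (intro exI[of _ U] exI[of _ b]) simp
qed

text \<open>The points of the region with neighbourhoods of one status form an open set, and likewise
  for the other status. The two sets are disjoint, because every nonempty open set meets a face, and the
  region is connected, so only one status occurs.\<close>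

lemma region_status:
  assumes P: "P \<subseteq> edges G" and A: "boundary2 G (topspace (surf G)) A \<subseteq> P"
    and S: "S \<in> regions G P" and f: "f \<in> faces G" "f \<subseteq> S" "f' \<in> faces G" "f' \<subseteq> S"
    and "f \<in> A"
  shows "f' \<in> A"
proof (rule ccontr)
  assume "f' \<notin> A"
  define B where "B b = \<Union>{N. openin (surf G) N \<and> (\<forall>f\<in>faces G. f \<inter> N \<noteq> {} \<longrightarrow> (f \<in> A \<longleftrightarrow> b))}" for b
  have op: "openin (surf G) (B b)" for b unfolding B_def by blast
  have B: "f \<in> A \<longleftrightarrow> b" if "f \<in> faces G" "f \<inter> B b \<noteq> {}" for f b
    using that unfolding B_def by blast
  have cover: "S \<subseteq> B True \<union> B False"
  proof
    fix y assume "y \<in> S"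
    then have "y \<in> topspace (surf G)" "y \<notin> support G P" using regions(3)[OF P S] by auto
    from local_status[OF P A this] obtain N b
      where "openin (surf G) N" "y \<in> N" "\<forall>f\<in>faces G. f \<inter> N \<noteq> {} \<longrightarrow> (f \<in> A \<longleftrightarrow> b)" by blast
    then have "y \<in> B b" unfolding B_def by blast
    then show "y \<in> B True \<union> B False" by (cases b) auto
  qed
  have disj: "B True \<inter> B False = {}"
  proof (rule ccontr)
    assume "B True \<inter> B False \<noteq> {}"
    then obtain y where "y \<in> B True \<inter> B False" by blast
    then obtain k where "k \<in> faces G" "k \<inter> (B True \<inter> B False) \<noteq> {}"
      using open_meets_face[of "B True \<inter> B False" y] op by blast
    then show False using B[of k True] B[of k False] by blast
  qed
  have "f \<inter> B False = {}" "f' \<inter> B True = {}" using B f \<open>f \<in> A\<close> \<open>f' \<notin> A\<close> by blast+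
  then have "f \<subseteq> B True" "f' \<subseteq> B False" using cover f by blast+
  then have ne: "B True \<inter> S \<noteq> {}" "B False \<inter> S \<noteq> {}"
    using f face_props(3)[OF f(1)] face_props(3)[OF f(3)] by blast+
  show False using regions(2)[OF P S] op cover disj ne unfolding connectedin by blast
qed

lemma regions_empty: "regions G {} = {topspace (surf G)}"
  using connected_surf nonempty_surf connected_components_of_eq_singleton[of "surf G" "topspace (surf G)"]
  unfolding regions_def support_def by simp

section \<open>Homology classes as cosets of boundaries\<close>

abbreviation "whole \<equiv> topspace (surf G)"
abbreviation "bd \<equiv> boundary2 G whole"

lemma boundary2_sym_diff:
  "boundary2 G S (sym_diff A B) = sym_diff (boundary2 G S A) (boundary2 G S B)"
proof (rule set_eqI)
  fix e
  show "e \<in> boundary2 G S (sym_diff A B) \<longleftrightarrow> e \<in> sym_diff (boundary2 G S A) (boundary2 G S B)"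
  proof (cases "e \<in> edges_in G S")
    case True
    then have e: "e \<in> edges G" unfolding edges_in_def by blast
    obtain L R where "dual_ends G e = {L, R}" using dual_ends_two[OF e] .
    note * = mem_boundary2_iff[OF e this]
    show ?thesis unfolding Un_iff Diff_iff * by blast
  next
    case False
    then show ?thesis unfolding boundary2_def by blast
  qed
qed

lemma boundary2_empty: "boundary2 G S {} = {}"
  unfolding boundary2_def by simp

lemma bd_subset: "bd A \<subseteq> edges G"
  unfolding boundary2_def edges_in_topspace by blast

lemma polygons_finite: "Q \<in> polygons G S \<Longrightarrow> finite Q"
  and polygons_edges: "Q \<in> polygons G S \<Longrightarrow> Q \<subseteq> edges G"
  using finite_subset[OF _ finite_edges] unfolding polygons_def edges_in_def by blast+

lemma even_degree_sym_diff:
  assumes "finite Q" "finite Q'"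
  shows "even (degree_in G (sym_diff Q Q') v) \<longleftrightarrow> (even (degree_in G Q v) \<longleftrightarrow> even (degree_in G Q' v))"
proof -
  have *: "{e \<in> sym_diff Q Q'. p e} = sym_diff {e \<in> Q. p e} {e \<in> Q'. p e}" for p by blast
  have even: "even (card {e \<in> sym_diff Q Q'. p e}) \<longleftrightarrow>
      (even (card {e \<in> Q. p e}) \<longleftrightarrow> even (card {e \<in> Q'. p e}))" for p
    unfolding * using assms by (intro even_card_sym_diff) auto
  show ?thesis unfolding degree_in_def even_add even by argo
qed

lemma polygons_sym_diff:
  assumes "Q \<in> polygons G S" "Q' \<in> polygons G S"
  shows "sym_diff Q Q' \<in> polygons G S"
  using assms even_degree_sym_diff[OF polygons_finite[OF assms(1)] polygons_finite[OF assms(2)]]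
  unfolding polygons_def by blast

lemma empty_polygon: "{} \<in> polygons G S"
  unfolding polygons_def degree_in_def by simp

lemma equiv_homologous: "equiv (polygons G S) (homologous G S)"
proof (rule equivI)
  show "homologous G S \<subseteq> polygons G S \<times> polygons G S" unfolding homologous_def by blast
  show "refl_on (polygons G S) (homologous G S)"
    unfolding homologous_def refl_on_def using boundary2_empty by auto
  show "sym (homologous G S)" unfolding homologous_def sym_def by (auto simp: Un_commute)
  show "trans (homologous G S)"
  proof (rule transI)
    fix Q1 Q2 Q3 assume 1: "(Q1, Q2) \<in> homologous G S" and 2: "(Q2, Q3) \<in> homologous G S"
    obtain A B where A: "A \<subseteq> faces_in G S" "sym_diff Q1 Q2 = boundary2 G S A"
      and B: "B \<subseteq> faces_in G S" "sym_diff Q2 Q3 = boundary2 G S B"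
      using 1 2 unfolding homologous_def by blast
    have "sym_diff Q1 Q3 = sym_diff (sym_diff Q1 Q2) (sym_diff Q2 Q3)" by blast
    then have "sym_diff Q1 Q3 = boundary2 G S (sym_diff A B)" using A(2) B(2) boundary2_sym_diff by simp
    moreover have "sym_diff A B \<subseteq> faces_in G S" using A(1) B(1) by blast
    ultimately show "(Q1, Q3) \<in> homologous G S" using 1 2 unfolding homologous_def by blast
  qed
qed

lemma hom_class_eq_iff:
  "Q \<in> polygons G S \<Longrightarrow> Q' \<in> polygons G S \<Longrightarrow> hom_class G S Q = hom_class G S Q' \<longleftrightarrow> (Q, Q') \<in> homologous G S"
  unfolding hom_class_def using eq_equiv_class_iff[OF equiv_homologous] by blast

lemma H1_representative:
  assumes "\<epsilon> \<in> H1_in G S"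
  obtains Q where "Q \<in> polygons_of_class G S \<epsilon>"
  using assms unfolding H1_in_def polygons_of_class_def quotient_def hom_class_def by blast

lemma polygons_of_class_eq:
  assumes "Q \<in> polygons_of_class G S \<epsilon>"
  shows "polygons_of_class G S \<epsilon> = {Q'. (Q, Q') \<in> homologous G S}"
proof -
  have Q: "Q \<in> polygons G S" "\<epsilon> = hom_class G S Q" using assms unfolding polygons_of_class_def by auto
  show ?thesis
  proof (intro set_eqI)
    fix Q'
    have "Q' \<in> polygons G S" if "(Q, Q') \<in> homologous G S" using that unfolding homologous_def by blast
    then show "Q' \<in> polygons_of_class G S \<epsilon> \<longleftrightarrow> Q' \<in> {Q'. (Q, Q') \<in> homologous G S}"
      unfolding polygons_of_class_def Q(2) using hom_class_eq_iff[OF Q(1)] by auto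
  qed
qed

text \<open>That the class contains the whole coset uses that boundaries are polygon configurations.\<close>

lemma polygon_configs_eq:
  assumes "Q \<in> polygon_configs G \<epsilon>"
  shows "polygon_configs G \<epsilon> = (\<lambda>A. sym_diff Q (bd A)) ` Pow (faces G)"
proof -
  have Q: "Q \<in> polygons G whole" using assms unfolding polygons_of_class_def by blast
  have "(Q, Q') \<in> homologous G whole \<longleftrightarrow> (\<exists>A\<subseteq>faces G. Q' = sym_diff Q (bd A))" for Q'
  proof
    assume "(Q, Q') \<in> homologous G whole"
    then obtain A where "A \<subseteq> faces G" "sym_diff Q Q' = bd A"
      unfolding homologous_def faces_in_topspace by blast
    then show "\<exists>A\<subseteq>faces G. Q' = sym_diff Q (bd A)" by (intro exI[of _ A]) blast
  next
    assume "\<exists>A\<subseteq>faces G. Q' = sym_diff Q (bd A)"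
    then obtain A where A: "A \<subseteq> faces G" "Q' = sym_diff Q (bd A)" by blast
    then have "Q' \<in> polygons G whole" using polygons_sym_diff[OF Q boundary_is_polygon] by simp
    moreover have "sym_diff Q Q' = bd A" unfolding A(2) by blast
    ultimately show "(Q, Q') \<in> homologous G whole"
      using A(1) Q unfolding homologous_def faces_in_topspace by blast
  qed
  then show ?thesis unfolding polygons_of_class_eq[OF assms] by blast
qed

lemma null_configs_eq: "polygon_configs G (null_class G) = bd ` Pow (faces G)"
proof -
  have "{} \<in> polygon_configs G (null_class G)"
    using empty_polygon unfolding polygons_of_class_def by blast
  from polygon_configs_eq[OF this] show ?thesis by simp
qed

lemma sym_diff_null_class:
  assumes "Q \<in> polygon_configs G \<epsilon>" "P \<in> polygon_configs G (null_class G)"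
  shows "sym_diff Q P \<in> polygon_configs G \<epsilon>"
proof -
  obtain A where "A \<in> Pow (faces G)" "P = bd A" using assms(2) unfolding null_configs_eq by blast
  then show ?thesis unfolding polygon_configs_eq[OF assms(1)] by (intro image_eqI[of _ _ A]) simp_all
qed

lemma finite_polygons: "finite (polygons G S)"
proof (rule finite_subset)
  show "polygons G S \<subseteq> Pow (edges G)" using polygons_edges[of _ S] by blast
qed (simp add: finite_edges)

lemma finite_polygons_of_class: "finite (polygons_of_class G S \<eta>)"
  using finite_polygons[of S] by (rule rev_finite_subset) (auto simp: polygons_of_class_def)

lemma finite_H1: "finite (H1_in G S)"
  unfolding H1_in_def using equiv_homologous finite_polygons
  by (intro finite_quotient) (auto simp: homologous_def)

lemma finite_null_configs: "finite (polygon_configs G (null_class G))"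
  by (rule finite_polygons_of_class)

definition faces_within :: "'a set set \<Rightarrow> 'a set set" where
  "faces_within \<S> = {f \<in> faces G. \<exists>S\<in>\<S>. f \<subseteq> S}"

lemma bd_faces_within:
  assumes P: "P \<subseteq> edges G" and "\<S> \<subseteq> regions G P"
  shows "bd (faces_within \<S>) \<subseteq> P"
proof
  fix e assume e: "e \<in> bd (faces_within \<S>)"
  then have e': "e \<in> edges G" using bd_subset by blast
  obtain L R where LR: "L \<in> faces G" "R \<in> faces G" "dual_ends G e = {L, R}" using dual_ends_two[OF e'] .
  then have ne: "(L \<in> faces_within \<S>) \<noteq> (R \<in> faces_within \<S>)" using e mem_boundary2_iff[OF e' LR(3)] by simp
  show "e \<in> P"
  proof (rule ccontr)
    assume "e \<notin> P"
    then have "L \<subseteq> S \<longleftrightarrow> R \<subseteq> S" if "S \<in> \<S>" for S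
    proof -
      have S: "S \<in> regions G P" using that assms(2) by blast
      have "L \<in> dual_ends G e" "R \<in> dual_ends G e" using LR(3) by simp_all
      then show ?thesis
        using dual_end_region[OF P e' \<open>e \<notin> P\<close> _ S, of L] dual_end_region[OF P e' \<open>e \<notin> P\<close> _ S, of R] by simp
    qed
    then show False using ne LR unfolding faces_within_def by blast
  qed
qed

lemma faces_within_inj:
  assumes P: "P \<subseteq> edges G"
  shows "inj_on faces_within (Pow (regions G P))"
proof -
  have *: "\<S> = {S \<in> regions G P. \<exists>f\<in>faces_within \<S>. f \<subseteq> S}" if "\<S> \<subseteq> regions G P" for \<S>
  proof (intro equalityI subsetI)
    fix S assume S: "S \<in> \<S>"
    then have "S \<in> regions G P" using that by blast
    from region_has_face[OF P this] obtain f where "f \<in> faces G" "f \<subseteq> S" .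
    then show "S \<in> {S \<in> regions G P. \<exists>f\<in>faces_within \<S>. f \<subseteq> S}"
      using S that unfolding faces_within_def by blast
  next
    fix S assume "S \<in> {S \<in> regions G P. \<exists>f\<in>faces_within \<S>. f \<subseteq> S}"
    then obtain f S' where S: "S \<in> regions G P" "f \<in> faces G" "f \<subseteq> S" "S' \<in> \<S>" "f \<subseteq> S'"
      unfolding faces_within_def by blast
    have "S \<inter> S' \<noteq> {}" using S(3,5) face_props(3)[OF S(2)] by blast
    then have "S = S'" using that S(1,4) by (intro regions_disjoint[OF P]) blast+
    then show "S \<in> \<S>" using S(4) by simp
  qed
  show ?thesis
    by (rule inj_on_inverseI[where g = "\<lambda>B. {S \<in> regions G P. \<exists>f\<in>B. f \<subseteq> S}"]) (simp add: *[symmetric])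
qed

lemma faces_within_surj:
  assumes P: "P \<subseteq> edges G" and B: "B \<subseteq> faces G" "bd B \<subseteq> P"
  obtains \<S> where "\<S> \<subseteq> regions G P" "faces_within \<S> = B"
proof
  let ?S = "{S \<in> regions G P. \<exists>f\<in>B. f \<subseteq> S}"
  show "?S \<subseteq> regions G P" by blast
  show "faces_within ?S = B"
  proof (intro equalityI subsetI)
    fix f assume "f \<in> faces_within ?S"
    then obtain S f' where "f \<in> faces G" "S \<in> regions G P" "f' \<in> B" "f' \<subseteq> S" "f \<subseteq> S"
      unfolding faces_within_def by blast
    then show "f \<in> B" using region_status[OF P B(2)] B(1) by blast
  next
    fix f assume f: "f \<in> B"
    then have "f \<in> faces G" using B(1) by blast
    from face_in_region[OF P this] obtain S where "S \<in> regions G P" "f \<subseteq> S" .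
    then show "f \<in> faces_within ?S" using f B(1) unfolding faces_within_def by blast
  qed
qed

text \<open>The freedom in \<open>A\<close> is to change the status of all faces of some of the regions.\<close>

lemma card_same_boundary_off:
  assumes P: "P \<subseteq> edges G" and A: "A \<subseteq> faces G"
  shows "card {A' \<in> Pow (faces G). bd A' - P = bd A - P} = 2 ^ card (regions G P)"
proof -
  have "bij_betw (\<lambda>\<S>. sym_diff A (faces_within \<S>)) (Pow (regions G P))
          {A' \<in> Pow (faces G). bd A' - P = bd A - P}"
  proof (rule bij_betw_imageI)
    show "inj_on (\<lambda>\<S>. sym_diff A (faces_within \<S>)) (Pow (regions G P))"
    proof (rule inj_onI)
      fix \<S> \<S>' assume *: "\<S> \<in> Pow (regions G P)" "\<S>' \<in> Pow (regions G P)"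
         "sym_diff A (faces_within \<S>) = sym_diff A (faces_within \<S>')"
      then have "faces_within \<S> = faces_within \<S>'" by blast
      then show "\<S> = \<S>'" using faces_within_inj[OF P] * unfolding inj_on_def by blast
    qed
    show "(\<lambda>\<S>. sym_diff A (faces_within \<S>)) ` Pow (regions G P) =
        {A' \<in> Pow (faces G). bd A' - P = bd A - P}"
    proof (intro equalityI subsetI)
      fix A' assume "A' \<in> (\<lambda>\<S>. sym_diff A (faces_within \<S>)) ` Pow (regions G P)"
      then obtain \<S> where S: "\<S> \<subseteq> regions G P" "A' = sym_diff A (faces_within \<S>)" by blast
      then have "bd A' = sym_diff (bd A) (bd (faces_within \<S>))" using boundary2_sym_diff by simp
      then have "bd A' - P = bd A - P" using bd_faces_within[OF P S(1)] by blast
      moreover have "A' \<subseteq> faces G" using A S(2) unfolding faces_within_def by blast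
      ultimately show "A' \<in> {A' \<in> Pow (faces G). bd A' - P = bd A - P}" by blast
    next
      fix A' assume A': "A' \<in> {A' \<in> Pow (faces G). bd A' - P = bd A - P}"
      have "bd (sym_diff A A') \<subseteq> P" unfolding boundary2_sym_diff using A' by blast
      moreover have "sym_diff A A' \<subseteq> faces G" using A A' by blast
      ultimately obtain \<S> where S: "\<S> \<subseteq> regions G P" "faces_within \<S> = sym_diff A A'"
        using faces_within_surj[OF P] by metis
      have "A' = sym_diff A (faces_within \<S>)" unfolding S(2) by blast
      then show "A' \<in> (\<lambda>\<S>. sym_diff A (faces_within \<S>)) ` Pow (regions G P)" using S(1) by blast
    qed
  qed
  then have "card (Pow (regions G P)) = card {A' \<in> Pow (faces G). bd A' - P = bd A - P}"
    by (rule bij_betw_same_card)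
  then show ?thesis using card_Pow[OF finite_regions[OF P]] by simp
qed

text \<open>The whole surface is the only region of the empty set of edges, so that every element of the
  class comes from exactly two sets of faces, complementary to each other.\<close>

lemma sum_over_class:
  fixes F :: "'e set \<Rightarrow> real"
  assumes Q: "Q \<in> polygon_configs G \<epsilon>"
  shows "(\<Sum>A\<in>Pow (faces G). F (sym_diff Q (bd A))) = 2 * (\<Sum>Q'\<in>polygon_configs G \<epsilon>. F Q')"
proof -
  have "card {A' \<in> Pow (faces G). sym_diff Q (bd A') = sym_diff Q (bd A)} = 2" if "A \<in> Pow (faces G)" for A
  proof -
    have "{A' \<in> Pow (faces G). sym_diff Q (bd A') = sym_diff Q (bd A)}
        = {A' \<in> Pow (faces G). bd A' - {} = bd A - {}}" by blast
    then show ?thesis using card_same_boundary_off[of "{}" A] that regions_empty by simp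
  qed
  then have "(\<Sum>A\<in>Pow (faces G). F (sym_diff Q (bd A))) =
      real 2 * (\<Sum>y\<in>(\<lambda>A. sym_diff Q (bd A)) ` Pow (faces G). F y)"
    using finite_faces by (intro sum_constant_fibres) auto
  then show ?thesis unfolding polygon_configs_eq[OF Q] by simp
qed

section \<open>Restriction to the regions\<close>

text \<open>All edges at a vertex inside the region lie in the region, so degrees do not change.\<close>

lemma restrict_polygon:
  assumes P: "P \<subseteq> edges G" and S: "S \<in> regions G P" and Q: "Q \<in> polygons G whole"
  shows "Q \<inter> edges_in G S \<in> polygons G S"
proof -
  have QE: "Q \<subseteq> edges G" using polygons_edges[OF Q] .
  have "even (degree_in G (Q \<inter> edges_in G S) v)" if v: "v \<in> verts_in G S" for v
  proof -
    have vS: "v \<in> S" and vG: "v \<in> verts G" using v unfolding verts_in_def by auto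
    have "{e \<in> Q \<inter> edges_in G S. param G e a = v} = {e \<in> Q. param G e a = v}" if "a \<in> {0, 1}" for a
      using edge_at_vertex_in_region[OF P S vS _ that] QE by blast
    then have "degree_in G (Q \<inter> edges_in G S) v = degree_in G Q v" unfolding degree_in_def by simp
    then show ?thesis using Q vG unfolding polygons_def verts_in_topspace by simp
  qed
  then show ?thesis unfolding polygons_def by blast
qed

lemma boundary2_restrict:
  assumes P: "P \<subseteq> edges G" and S: "S \<in> regions G P"
  shows "bd A \<inter> edges_in G S = boundary2 G S (A \<inter> faces_in G S)"
proof (rule set_eqI)
  fix e
  show "e \<in> bd A \<inter> edges_in G S \<longleftrightarrow> e \<in> boundary2 G S (A \<inter> faces_in G S)"
  proof (cases "e \<in> edges_in G S")
    case True
    then have e: "e \<in> edges G" "e \<notin> P" using edges_in_region[OF P S] by auto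
    obtain L R where LR: "L \<in> faces G" "R \<in> faces G" "dual_ends G e = {L, R}" using dual_ends_two[OF e(1)] .
    have "L \<in> dual_ends G e" "R \<in> dual_ends G e" using LR(3) by simp_all
    then have "L \<in> faces_in G S" "R \<in> faces_in G S"
      using True LR(1,2) dual_end_region[OF P e _ S] unfolding faces_in_def by auto
    then show ?thesis
      using True e(1) mem_boundary2_iff[OF e(1) LR(3), of whole A]
        mem_boundary2_iff[OF e(1) LR(3), of S "A \<inter> faces_in G S"]
      by (simp add: edges_in_topspace)
  next
    case False
    then show ?thesis unfolding boundary2_def by blast
  qed
qed

lemma restrict_class_eq:
  assumes P: "P \<subseteq> edges G" and S: "S \<in> regions G P" and Q: "Q \<in> polygon_configs G \<epsilon>"
  shows "restrict_class G S \<epsilon> = hom_class G S (Q \<inter> edges_in G S)"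
proof -
  have "hom_class G S (Q' \<inter> edges_in G S) = hom_class G S (Q \<inter> edges_in G S)"
    if Q': "Q' \<in> polygon_configs G \<epsilon>" for Q'
  proof -
    obtain A where A: "Q' = sym_diff Q (bd A)"
      using Q' unfolding polygon_configs_eq[OF Q] by blast
    have pol: "Q \<in> polygons G whole" "Q' \<in> polygons G whole" using Q Q' unfolding polygons_of_class_def by auto
    have "sym_diff (Q' \<inter> edges_in G S) (Q \<inter> edges_in G S) = bd A \<inter> edges_in G S"
      unfolding A by blast
    then have "sym_diff (Q' \<inter> edges_in G S) (Q \<inter> edges_in G S) = boundary2 G S (A \<inter> faces_in G S)"
      using boundary2_restrict[OF P S] by simp
    then have "(Q' \<inter> edges_in G S, Q \<inter> edges_in G S) \<in> homologous G S"
      using restrict_polygon[OF P S] pol unfolding homologous_def by blast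
    then show ?thesis using hom_class_eq_iff restrict_polygon[OF P S] pol by blast
  qed
  then have "(\<lambda>Q. hom_class G S (Q \<inter> edges_in G S)) ` polygon_configs G \<epsilon> = {hom_class G S (Q \<inter> edges_in G S)}"
    using Q by blast
  then show ?thesis unfolding restrict_class_def by simp
qed

text \<open>Configurations chosen independently in the regions, each in the restricted class, differ
  from the restrictions of \<open>Q\<close> by boundaries of sets of faces of the regions. The union of
  these sets of faces moves \<open>Q\<close> to an element of its class that has the chosen
  restrictions.\<close>

lemma restrictions_eq:
  assumes P: "P \<subseteq> edges G" and Q: "Q \<in> polygon_configs G \<epsilon>"
  shows "(\<lambda>A. \<lambda>S\<in>regions G P. sym_diff Q (bd A) \<inter> edges_in G S) ` Pow (faces G) =
         (\<Pi>\<^sub>E S\<in>regions G P. polygons_of_class G S (restrict_class G S \<epsilon>))" (is "?\<rho> ` _ = _")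
proof (intro equalityI subsetI)
  fix \<tau> assume "\<tau> \<in> ?\<rho> ` Pow (faces G)"
  then obtain A where A: "A \<subseteq> faces G" "\<tau> = ?\<rho> A" by blast
  then have Q': "sym_diff Q (bd A) \<in> polygon_configs G \<epsilon>" unfolding polygon_configs_eq[OF Q] by blast
  then have pol: "sym_diff Q (bd A) \<in> polygons G whole" unfolding polygons_of_class_def by blast
  show "\<tau> \<in> (\<Pi>\<^sub>E S\<in>regions G P. polygons_of_class G S (restrict_class G S \<epsilon>))"
    unfolding A(2) polygons_of_class_def
    using restrict_class_eq[OF P _ Q'] restrict_polygon[OF P _ pol] by (intro restrict_PiE_iff[THEN iffD2]) simp
next
  fix \<tau> assume \<tau>: "\<tau> \<in> (\<Pi>\<^sub>E S\<in>regions G P. polygons_of_class G S (restrict_class G S \<epsilon>))"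
  have pol: "Q \<in> polygons G whole" using Q unfolding polygons_of_class_def by blast
  have "\<exists>A\<subseteq>faces_in G S. sym_diff (Q \<inter> edges_in G S) (\<tau> S) = boundary2 G S A" if S: "S \<in> regions G P" for S
  proof -
    have "\<tau> S \<in> polygons_of_class G S (restrict_class G S \<epsilon>)" using \<tau> S by (rule PiE_mem)
    then have "\<tau> S \<in> polygons G S" "hom_class G S (Q \<inter> edges_in G S) = hom_class G S (\<tau> S)"
      unfolding polygons_of_class_def restrict_class_eq[OF P S Q] by auto
    then have "(Q \<inter> edges_in G S, \<tau> S) \<in> homologous G S"
      using hom_class_eq_iff restrict_polygon[OF P S pol] by blast
    then show ?thesis unfolding homologous_def by blast
  qed
  then obtain \<A> where \<A>: "\<And>S. S \<in> regions G P \<Longrightarrow> \<A> S \<subseteq> faces_in G S"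
    "\<And>S. S \<in> regions G P \<Longrightarrow> sym_diff (Q \<inter> edges_in G S) (\<tau> S) = boundary2 G S (\<A> S)"
    by metis
  define A where "A = (\<Union>S\<in>regions G P. \<A> S)"
  have "?\<rho> A = \<tau>"
  proof (rule extensionalityI[of _ "regions G P"])
    show "?\<rho> A \<in> extensional (regions G P)" by simp
    show "\<tau> \<in> extensional (regions G P)" using \<tau> by (simp add: PiE_iff)
    fix S assume S: "S \<in> regions G P"
    have "S' = S" if "S' \<in> regions G P" "f \<in> \<A> S'" "f \<in> faces_in G S" for S' f
    proof (rule regions_disjoint[OF P that(1) S])
      have "f \<subseteq> S'" "f \<subseteq> S" "f \<in> faces G" using that \<A>(1)[OF that(1)] unfolding faces_in_def by auto
      then show "S' \<inter> S \<noteq> {}" using face_props(3)[of f] by blast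
    qed
    then have "A \<inter> faces_in G S = \<A> S" using S \<A>(1)[OF S] unfolding A_def by blast
    then have "bd A \<inter> edges_in G S = sym_diff (Q \<inter> edges_in G S) (\<tau> S)"
      using boundary2_restrict[OF P S, of A] \<A>(2)[OF S] by simp
    then have "sym_diff Q (bd A) \<inter> edges_in G S = \<tau> S" by blast
    then show "?\<rho> A S = \<tau> S" using S by simp
  qed
  moreover have "A \<subseteq> faces G" using \<A>(1) unfolding A_def faces_in_def by blast
  ultimately show "\<tau> \<in> ?\<rho> ` Pow (faces G)" by blast
qed

lemma Union_edges_in_regions:
  assumes P: "P \<subseteq> edges G" and "Q \<subseteq> edges G"
  shows "(\<Union>S\<in>regions G P. Q \<inter> edges_in G S) = Q - P"
proof (intro equalityI subsetI)
  fix e assume "e \<in> (\<Union>S\<in>regions G P. Q \<inter> edges_in G S)"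
  then show "e \<in> Q - P" using edges_in_region[OF P] by blast
next
  fix e assume e: "e \<in> Q - P"
  then have "e \<in> edges G" "e \<notin> P" using assms by auto
  from edge_in_region[OF P this] obtain S where "S \<in> regions G P" "open_edge G e \<subseteq> S" .
  then show "e \<in> (\<Union>S\<in>regions G P. Q \<inter> edges_in G S)"
    using e \<open>e \<in> edges G\<close> unfolding edges_in_def by blast
qed

lemma edges_in_disjoint:
  assumes P: "P \<subseteq> edges G" and "S \<in> regions G P" "S' \<in> regions G P" "S \<noteq> S'"
  shows "edges_in G S \<inter> edges_in G S' = {}"
proof (rule ccontr)
  assume "\<not> ?thesis"
  then obtain e where "open_edge G e \<subseteq> S" "open_edge G e \<subseteq> S'" unfolding edges_in_def by blast
  then have "S \<inter> S' \<noteq> {}" using open_edge_nonempty[of e] by blast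
  then show False using regions_disjoint assms by blast
qed

text \<open>The factor \<open>2\<close> on the left is the number of sets of faces giving the same
  element of the class, and the factor \<open>2\<close> of each region comes from the \<open>2 ^
  n\<close> sets of faces giving the same restrictions.\<close>

lemma sum_class_product:
  assumes P: "P \<subseteq> edges G" and Q: "Q \<in> polygon_configs G \<epsilon>"
  shows "2 * (\<Sum>Q\<in>polygon_configs G \<epsilon>. \<Prod>e\<in>Q - P. exp (- 4 * J e)) =
         (\<Prod>S\<in>regions G P. 2 * Z_LT G S (restrict_class G S \<epsilon>) (\<lambda>e. 2 * J e))"
proof -
  let ?R = "regions G P"
  define \<rho> where "\<rho> A = (\<lambda>S\<in>?R. sym_diff Q (bd A) \<inter> edges_in G S)" for A
  define H where "H \<tau> = (\<Prod>S\<in>?R. \<Prod>e\<in>\<tau> S. exp (- 4 * J e))" for \<tau>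
  have fin: "finite ?R" by (rule finite_regions[OF P])
  have QE: "sym_diff Q (bd A) \<subseteq> edges G" for A
    using Q bd_subset polygons_edges[of Q whole] unfolding polygons_of_class_def by blast
  have off: "sym_diff Q (bd A) - P = (\<Union>S\<in>?R. \<rho> A S)" for A
  proof -
    have "(\<Union>S\<in>?R. \<rho> A S) = (\<Union>S\<in>?R. sym_diff Q (bd A) \<inter> edges_in G S)"
      unfolding \<rho>_def by simp
    then show ?thesis using Union_edges_in_regions[OF P QE[of A]] by simp
  qed
  have split: "(\<Prod>e\<in>sym_diff Q (bd A) - P. exp (- 4 * J e)) = H (\<rho> A)" for A
    unfolding off H_def
  proof (rule prod.UNION_disjoint[OF fin])
    show "\<forall>S\<in>?R. finite (\<rho> A S)"
      using finite_subset[OF QE finite_edges, of A] unfolding \<rho>_def by simp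
    show "\<forall>S\<in>?R. \<forall>S'\<in>?R. S \<noteq> S' \<longrightarrow> \<rho> A S \<inter> \<rho> A S' = {}"
      using edges_in_disjoint[OF P] unfolding \<rho>_def by (auto simp: disjoint_iff)
  qed
  have fibre: "card {A' \<in> Pow (faces G). \<rho> A' = \<rho> A} = 2 ^ card ?R" if A: "A \<in> Pow (faces G)" for A
  proof -
    have "\<rho> A' = \<rho> A \<longleftrightarrow> bd A' - P = bd A - P" for A'
    proof
      assume "\<rho> A' = \<rho> A"
      then have "sym_diff Q (bd A') - P = sym_diff Q (bd A) - P" unfolding off by simp
      then show "bd A' - P = bd A - P" by blast
    next
      assume same: "bd A' - P = bd A - P"
      have "sym_diff Q (bd A') \<inter> edges_in G S = sym_diff Q (bd A) \<inter> edges_in G S" if "S \<in> ?R" for S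
        using same edges_in_region[OF P that] by blast
      then show "\<rho> A' = \<rho> A" unfolding \<rho>_def by (intro restrict_ext)
    qed
    then show ?thesis using card_same_boundary_off[OF P, of A] A by simp
  qed
  have "2 * (\<Sum>Q\<in>polygon_configs G \<epsilon>. \<Prod>e\<in>Q - P. exp (- 4 * J e)) = (\<Sum>A\<in>Pow (faces G). H (\<rho> A))"
    using sum_over_class[OF Q, of "\<lambda>Q. \<Prod>e\<in>Q - P. exp (- 4 * J e)"] split by simp
  also have "\<dots> = real (2 ^ card ?R) * (\<Sum>\<tau>\<in>\<rho> ` Pow (faces G). H \<tau>)"
    using finite_faces fibre by (intro sum_constant_fibres) auto
  also have "\<rho> ` Pow (faces G) = (\<Pi>\<^sub>E S\<in>?R. polygons_of_class G S (restrict_class G S \<epsilon>))"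
    using restrictions_eq[OF P Q] unfolding \<rho>_def .
  also have "(\<Sum>\<tau>\<in>(\<Pi>\<^sub>E S\<in>?R. polygons_of_class G S (restrict_class G S \<epsilon>)). H \<tau>) =
      (\<Prod>S\<in>?R. \<Sum>Q\<in>polygons_of_class G S (restrict_class G S \<epsilon>). \<Prod>e\<in>Q. exp (- 4 * J e))"
    unfolding H_def using fin finite_polygons_of_class by (intro prod_sum_PiE[symmetric])
  finally show ?thesis unfolding Z_LT_def by (simp add: prod.distrib)
qed

text \<open>An edge of \<open>P\<close> belongs to exactly one of the two configurations, an edge of
  \<open>Q - P\<close> to both.\<close>

lemma weight_mono:
  assumes "finite Q" "finite P"
  shows "weight G J (Q, sym_diff Q P) =
         C_const G J * (\<Prod>e\<in>P. exp (- 2 * J e)) * (\<Prod>e\<in>Q - P. exp (- 4 * J e))"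
proof -
  define w where "w e = exp (- 2 * J e)" for e
  have Q: "prod w Q = prod w (Q - P) * prod w (Q \<inter> P)"
    using prod.Int_Diff[OF assms(1), of w P] by (simp add: mult.commute)
  have QP: "prod w (sym_diff Q P) = prod w (Q - P) * prod w (P - Q)"
    using assms by (intro prod.union_disjoint) auto
  have P: "prod w P = prod w (Q \<inter> P) * prod w (P - Q)"
    using prod.Int_Diff[OF assms(2), of w Q] by (simp add: Int_commute)
  have "exp (- 4 * J e) = w e * w e" for e
    unfolding w_def by (simp flip: exp_add)
  then have off: "(\<Prod>e\<in>Q - P. exp (- 4 * J e)) = prod w (Q - P) * prod w (Q - P)"
    by (simp add: prod.distrib)
  have "weight G J (Q, sym_diff Q P) = C_const G J * prod w Q * prod w (sym_diff Q P)"
    unfolding weight_def w_def by simp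
  also have "\<dots> = C_const G J * prod w P * (\<Prod>e\<in>Q - P. exp (- 4 * J e))"
    unfolding Q QP P off by (simp only: ac_simps)
  finally show ?thesis unfolding w_def .
qed

lemma W_class_eq:
  assumes P: "P \<in> polygon_configs G (null_class G)" and \<epsilon>: "\<epsilon> \<in> H1 G"
  shows "W_class G J \<epsilon> P = 1 / 2 * C_const G J * (\<Prod>e\<in>P. exp (- 2 * J e)) *
           (\<Prod>S\<in>regions G P. 2 * Z_LT G S (restrict_class G S \<epsilon>) (\<lambda>e. 2 * J e))"
proof -
  have Ppol: "P \<in> polygons G whole" using P unfolding polygons_of_class_def by blast
  have PE: "P \<subseteq> edges G" using polygons_edges[OF Ppol] .
  obtain Q where Q: "Q \<in> polygon_configs G \<epsilon>" using H1_representative[OF \<epsilon>] .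
  let ?\<Omega> = "{\<omega>. \<omega> \<in> polygon_configs G \<epsilon> \<times> polygon_configs G \<epsilon> \<and> Mono \<omega> = P}"
  have "?\<Omega> = (\<lambda>Q. (Q, sym_diff Q P)) ` polygon_configs G \<epsilon>"
  proof (intro equalityI subsetI)
    fix \<omega> assume "\<omega> \<in> ?\<Omega>"
    then obtain R B where "\<omega> = (R, B)" "R \<in> polygon_configs G \<epsilon>" "P = sym_diff R B"
      unfolding Mono_def by auto
    moreover have "B = sym_diff R (sym_diff R B)" by blast
    ultimately show "\<omega> \<in> (\<lambda>Q. (Q, sym_diff Q P)) ` polygon_configs G \<epsilon>" by blast
  next
    fix \<omega> assume "\<omega> \<in> (\<lambda>Q. (Q, sym_diff Q P)) ` polygon_configs G \<epsilon>"
    then obtain R where R: "R \<in> polygon_configs G \<epsilon>" "\<omega> = (R, sym_diff R P)" by blast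
    moreover have "sym_diff R (sym_diff R P) = P" by blast
    ultimately show "\<omega> \<in> ?\<Omega>" using sym_diff_null_class[OF R(1) P] unfolding Mono_def by simp
  qed
  then have "W_class G J \<epsilon> P = (\<Sum>Q\<in>polygon_configs G \<epsilon>. weight G J (Q, sym_diff Q P))"
    unfolding W_class_def by (simp add: sum.reindex inj_on_def)
  also have "\<dots> = (\<Sum>Q\<in>polygon_configs G \<epsilon>.
      C_const G J * (\<Prod>e\<in>P. exp (- 2 * J e)) * (\<Prod>e\<in>Q - P. exp (- 4 * J e)))"
    using polygons_finite polygons_finite[OF Ppol] 
    by (intro sum.cong refl weight_mono) (auto simp: polygons_of_class_def)
  also have "\<dots> = C_const G J * (\<Prod>e\<in>P. exp (- 2 * J e)) *
      (\<Sum>Q\<in>polygon_configs G \<epsilon>. \<Prod>e\<in>Q - P. exp (- 4 * J e))"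
    by (simp add: sum_distrib_left)
  also have "(\<Sum>Q\<in>polygon_configs G \<epsilon>. \<Prod>e\<in>Q - P. exp (- 4 * J e)) = 
      1 / 2 * (\<Prod>S\<in>regions G P. 2 * Z_LT G S (restrict_class G S \<epsilon>) (\<lambda>e. 2 * J e))"
    using sum_class_product[OF PE Q, of J] by simp
  finally show ?thesis by simp
qed

section \<open>The low-temperature expansion and the double Ising measure\<close>

lemma spin_product_boundary:
  assumes e: "e \<in> edges G"
  shows "spin_product G (\<lambda>f\<in>faces G. if f \<in> A then - 1 else 1) e = (if e \<in> bd A then - 1 else 1)"
proof -
  obtain L R where LR: "L \<in> faces G" "R \<in> faces G" "dual_ends G e = {L, R}" using dual_ends_two[OF e] .
  have "e \<in> bd A \<longleftrightarrow> (L \<in> A) \<noteq> (R \<in> A)"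
    using mem_boundary2_iff[OF e LR(3), of whole A] e edges_in_topspace by simp
  then show ?thesis using LR(1,2) unfolding spin_product_def LR(3)
    by (cases "L = R"; cases "L \<in> A"; cases "R \<in> A") simp_all
qed

text \<open>A spin configuration is determined by the set \<open>A\<close> of faces with spin \<open>-
  1\<close>, and \<open>bd A\<close> is its domain wall.\<close>

lemma Z_spin_eq_sum_Pow:
  "Z_spin G K = (\<Sum>A\<in>Pow (faces G). exp (\<Sum>e\<in>edges G. K e * (if e \<in> bd A then - 1 else 1)))"
proof -
  define \<sigma> where "\<sigma> A = (\<lambda>f\<in>faces G. if f \<in> A then - 1 else (1::real))" for A
  have inv: "{f \<in> faces G. \<sigma> A f = - 1} = A" if "A \<subseteq> faces G" for A
    using that unfolding \<sigma>_def by auto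
  have "bij_betw \<sigma> (Pow (faces G)) (faces G \<rightarrow>\<^sub>E {-1, 1})"
  proof (rule bij_betw_imageI)
    show "inj_on \<sigma> (Pow (faces G))"
      by (rule inj_on_inverseI[where g = "\<lambda>s. {f \<in> faces G. s f = - 1}"]) (simp add: inv)
    show "\<sigma> ` Pow (faces G) = faces G \<rightarrow>\<^sub>E {-1, 1}"
    proof (intro equalityI subsetI)
      fix s assume s: "s \<in> faces G \<rightarrow>\<^sub>E {-1, 1::real}"
      have "s = \<sigma> {f \<in> faces G. s f = - 1}"
        by (rule extensionalityI[of _ "faces G"]) (use s in \<open>auto simp: \<sigma>_def PiE_iff\<close>)
      then show "s \<in> \<sigma> ` Pow (faces G)" by blast
    qed (auto simp: \<sigma>_def)
  qed
  then have "Z_spin G K = (\<Sum>A\<in>Pow (faces G). exp (\<Sum>e\<in>edges G. K e * spin_product G (\<sigma> A) e))"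
    unfolding Z_spin_def by (rule sum.reindex_bij_betw[symmetric])
  then show ?thesis unfolding \<sigma>_def by (simp add: spin_product_boundary)
qed

text \<open>An edge has weight \<open>exp (J e)\<close> if the product of its spins has the sign of the
  coupling, and \<open>exp (- 2 * J e)\<close> times this otherwise. The second case occurs on the
  symmetric difference of \<open>R\<close> and the domain wall, which runs over the class of
  \<open>R\<close> twice.\<close>

lemma Z_Ising_low_temperature:
  assumes \<epsilon>: "\<epsilon> \<in> H1 G"
  shows "Z_Ising G J \<epsilon> =
         2 * (\<Prod>e\<in>edges G. exp (J e)) * (\<Sum>Q\<in>polygon_configs G \<epsilon>. \<Prod>e\<in>Q. exp (- 2 * J e))"
proof -
  define R where "R = (SOME R. R \<in> polygon_configs G \<epsilon>)"
  obtain R' where "R' \<in> polygon_configs G \<epsilon>" using H1_representative[OF \<epsilon>] .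
  then have R: "R \<in> polygon_configs G \<epsilon>" unfolding R_def by (rule someI)
  then have RE: "R \<subseteq> edges G" using polygons_edges[of R whole] unfolding polygons_of_class_def by blast
  have energy: "exp (\<Sum>e\<in>edges G. (if e \<in> R then - J e else J e) * (if e \<in> bd A then - 1 else 1)) =
      (\<Prod>e\<in>edges G. exp (J e)) * (\<Prod>e\<in>sym_diff R (bd A). exp (- 2 * J e))" for A
  proof -
    let ?Q = "sym_diff R (bd A)"
    have Q: "?Q \<subseteq> edges G" using RE bd_subset by blast
    have "exp (\<Sum>e\<in>edges G. (if e \<in> R then - J e else J e) * (if e \<in> bd A then - 1 else 1)) =
      (\<Prod>e\<in>edges G. exp (J e) * (if e \<in> ?Q then exp (- 2 * J e) else 1))"
      unfolding exp_sum[OF finite_edges] by (intro prod.cong refl) (auto simp flip: exp_add)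
    also have "\<dots> = (\<Prod>e\<in>edges G. exp (J e)) * (\<Prod>e\<in>edges G. if e \<in> ?Q then exp (- 2 * J e) else 1)"
      by (rule prod.distrib)
    also have "(\<Prod>e\<in>edges G. if e \<in> ?Q then exp (- 2 * J e) else 1) = (\<Prod>e\<in>edges G \<inter> ?Q. exp (- 2 * J e))"
      by (rule prod.inter_restrict[OF finite_edges, symmetric])
    also have "edges G \<inter> ?Q = ?Q" using Q by blast
    finally show ?thesis .
  qed
  have "Z_Ising G J \<epsilon> = (\<Sum>A\<in>Pow (faces G).
      (\<Prod>e\<in>edges G. exp (J e)) * (\<Prod>e\<in>sym_diff R (bd A). exp (- 2 * J e)))"
    unfolding Z_Ising_def Let_def R_def[symmetric] Z_spin_eq_sum_Pow energy ..
  also have "\<dots> = 2 * (\<Sum>Q\<in>polygon_configs G \<epsilon>. (\<Prod>e\<in>edges G. exp (J e)) * (\<Prod>e\<in>Q. exp (- 2 * J e)))"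
    by (rule sum_over_class[OF R, of "\<lambda>Q. (\<Prod>e\<in>edges G. exp (J e)) * (\<Prod>e\<in>Q. exp (- 2 * J e))"])
  finally show ?thesis by (simp add: sum_distrib_left mult.assoc)
qed

lemma finite_double_configs: "finite (double_configs G)"
  unfolding double_configs_def using finite_H1 finite_polygons_of_class by blast

lemma sum_double_configs:
  fixes F :: "'e set \<times> 'e set \<Rightarrow> real"
  shows "(\<Sum>\<omega>\<in>double_configs G. F \<omega>) =
         (\<Sum>\<epsilon>\<in>H1 G. \<Sum>\<omega>\<in>polygon_configs G \<epsilon> \<times> polygon_configs G \<epsilon>. F \<omega>)"
  unfolding double_configs_def
proof (rule sum.UNION_disjoint[OF finite_H1])
  show "\<forall>\<epsilon>\<in>H1 G. finite (polygon_configs G \<epsilon> \<times> polygon_configs G \<epsilon>)"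
    using finite_polygons_of_class by blast
  show "\<forall>\<epsilon>\<in>H1 G. \<forall>\<epsilon>'\<in>H1 G. \<epsilon> \<noteq> \<epsilon>' \<longrightarrow>
      polygon_configs G \<epsilon> \<times> polygon_configs G \<epsilon> \<inter> polygon_configs G \<epsilon>' \<times> polygon_configs G \<epsilon>' = {}"
    unfolding polygons_of_class_def by blast
qed

lemma Z_dIsing_eq_sum_weight: "Z_dIsing G J = (\<Sum>\<omega>\<in>double_configs G. weight G J \<omega>)"
proof -
  have "(Z_Ising G J \<epsilon>)\<^sup>2 = (\<Sum>\<omega>\<in>polygon_configs G \<epsilon> \<times> polygon_configs G \<epsilon>. weight G J \<omega>)"
    if "\<epsilon> \<in> H1 G" for \<epsilon>
  proof -
    let ?w = "\<lambda>Q. \<Prod>e\<in>Q. exp (- 2 * J e)" and ?K = "polygon_configs G \<epsilon>"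
    have "(\<Sum>\<omega>\<in>?K \<times> ?K. weight G J \<omega>) = (\<Sum>R\<in>?K. \<Sum>B\<in>?K. C_const G J * ?w R * ?w B)"
      unfolding weight_def by (simp add: sum.cartesian_product case_prod_unfold)
    also have "\<dots> = C_const G J * ((\<Sum>R\<in>?K. ?w R) * (\<Sum>B\<in>?K. ?w B))"
      unfolding sum_product by (simp only: sum_distrib_left mult.assoc)
    also have "\<dots> = (Z_Ising G J \<epsilon>)\<^sup>2"
      unfolding Z_Ising_low_temperature[OF that] C_const_def by (simp add: power2_eq_square ac_simps)
    finally show ?thesis ..
  qed
  then show ?thesis unfolding Z_dIsing_def sum_double_configs by (intro sum.cong refl)
qed

lemma Mono_in_null_configs:
  assumes "\<omega> \<in> double_configs G"
  shows "Mono \<omega> \<in> polygon_configs G (null_class G)"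
proof -
  obtain \<epsilon> R B where "\<omega> = (R, B)" and RB: "R \<in> polygon_configs G \<epsilon>" "B \<in> polygon_configs G \<epsilon>"
    using assms unfolding double_configs_def by blast
  obtain A where "A \<subseteq> faces G" "B = sym_diff R (bd A)"
    using RB(2) unfolding polygon_configs_eq[OF RB(1)] by blast
  moreover have "sym_diff R (sym_diff R (bd A)) = bd A" by blast
  ultimately show ?thesis unfolding null_configs_eq Mono_def \<open>\<omega> = (R, B)\<close> by simp
qed

lemma W_eq_sum_weight: "W G J P = (\<Sum>\<omega> | \<omega> \<in> double_configs G \<and> Mono \<omega> = P. weight G J \<omega>)"
proof -
  have "W G J P = (\<Sum>\<epsilon>\<in>H1 G. \<Sum>\<omega>\<in>polygon_configs G \<epsilon> \<times> polygon_configs G \<epsilon>.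
      if Mono \<omega> = P then weight G J \<omega> else 0)"
    unfolding W_def W_class_def
    by (intro sum.cong refl sum.inter_filter finite_cartesian_product finite_polygons_of_class)
  also have "\<dots> = (\<Sum>\<omega>\<in>double_configs G. if Mono \<omega> = P then weight G J \<omega> else 0)"
    by (rule sum_double_configs[symmetric])
  also have "\<dots> = (\<Sum>\<omega> | \<omega> \<in> double_configs G \<and> Mono \<omega> = P. weight G J \<omega>)"
    by (rule sum.inter_filter[symmetric, OF finite_double_configs])
  finally show ?thesis .
qed

lemma Z_dIsing_eq_sum_W: "Z_dIsing G J = (\<Sum>P\<in>polygon_configs G (null_class G). W G J P)"
  unfolding Z_dIsing_eq_sum_weight W_eq_sum_weight
  by (rule sum.group[symmetric, OF finite_double_configs finite_null_configs])
    (use Mono_in_null_configs in blast)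

lemma weight_pos: "0 < weight G J \<omega>"
proof -
  have "0 < (\<Prod>e\<in>Q. exp (c * J e))" for Q and c :: real by (rule prod_pos) simp
  from this[of 1 "edges G"] this[of "- 2"] show ?thesis
    unfolding weight_def C_const_def case_prod_unfold by (intro mult_pos_pos zero_less_power) auto
qed

lemma double_configs_nonempty: "double_configs G \<noteq> {}"
proof -
  have "null_class G \<in> H1 G"
    unfolding H1_in_def hom_class_def using empty_polygon by (intro quotientI)
  moreover have "{} \<in> polygon_configs G (null_class G)"
    using empty_polygon unfolding polygons_of_class_def by blast
  ultimately show ?thesis unfolding double_configs_def by blast
qed

lemma Z_dIsing_pos: "0 < Z_dIsing G J"
  unfolding Z_dIsing_eq_sum_weight
  using finite_double_configs double_configs_nonempty weight_pos by (intro sum_pos) auto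

lemma measure_P_dIsing:
  assumes "X \<subseteq> double_configs G"
  shows "emeasure (P_dIsing G J) X = ennreal ((\<Sum>\<omega>\<in>X. weight G J \<omega>) / Z_dIsing G J)"
proof -
  have "emeasure (P_dIsing G J) X = (\<Sum>\<omega>\<in>X. ennreal (weight G J \<omega> / Z_dIsing G J))"
    unfolding P_dIsing_def using finite_double_configs assms by (rule emeasure_point_measure_finite)
  also have "\<dots> = ennreal (\<Sum>\<omega>\<in>X. weight G J \<omega> / Z_dIsing G J)"
    using weight_pos Z_dIsing_pos by (intro sum_ennreal) (simp add: less_imp_le)
  finally show ?thesis by (simp add: sum_divide_distrib)
qed

lemma space_P_dIsing: "space (P_dIsing G J) = double_configs G"
  unfolding P_dIsing_def by (rule space_point_measure)

lemma prob_space_P_dIsing: "prob_space (P_dIsing G J)"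
proof (rule prob_spaceI)
  have "emeasure (P_dIsing G J) (space (P_dIsing G J)) = ennreal (Z_dIsing G J / Z_dIsing G J)"
    unfolding space_P_dIsing measure_P_dIsing[OF subset_refl] Z_dIsing_eq_sum_weight ..
  then show "emeasure (P_dIsing G J) (space (P_dIsing G J)) = 1"
    using Z_dIsing_pos[of J] by simp
qed

lemma measurable_Mono:
  "Mono \<in> P_dIsing G J \<rightarrow>\<^sub>M count_space (polygon_configs G (null_class G))"
  unfolding P_dIsing_def using Mono_in_null_configs by simp

lemma prob_Mono_eq:
  "measure (P_dIsing G J) {\<omega> \<in> space (P_dIsing G J). Mono \<omega> = P} = W G J P / Z_dIsing G J"
proof -
  let ?X = "{\<omega>. \<omega> \<in> double_configs G \<and> Mono \<omega> = P}"
  have "0 \<le> W G J P" unfolding W_eq_sum_weight using weight_pos by (intro sum_nonneg less_imp_le)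
  moreover have "?X \<subseteq> double_configs G" by blast
  then have "emeasure (P_dIsing G J) ?X = ennreal (W G J P / Z_dIsing G J)"
    unfolding W_eq_sum_weight by (rule measure_P_dIsing)
  ultimately show ?thesis
    using Z_dIsing_pos[of J] unfolding measure_def space_P_dIsing by simp
qed

lemma prob_distr_Mono:
  assumes "P \<in> polygon_configs G (null_class G)"
  shows "measure (distr (P_dIsing G J) (count_space (polygon_configs G (null_class G))) Mono) {P} =
         W G J P / Z_dIsing G J"
proof -
  have vimage: "Mono -` {P} \<inter> space (P_dIsing G J) = {\<omega> \<in> space (P_dIsing G J). Mono \<omega> = P}" by blast
  have "{P} \<in> sets (count_space (polygon_configs G (null_class G)))" using assms by simp
  from measure_distr[OF measurable_Mono this, of J] show ?thesis unfolding vimage prob_Mono_eq .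
qed

end

theorem proposition11:
  fixes G :: "('a, 'e) surface_graph" and J :: "'e \<Rightarrow> real"
  assumes "closed_orientable_surface (surf G)"
    and "cellularly_embedded G"
    and "\<forall>e\<in>edges G. 0 < J e"
  shows "(\<forall>P\<in>polygon_configs G (null_class G). \<forall>\<epsilon>\<in>H1 G.
            W_class G J \<epsilon> P =
              1 / 2 * C_const G J * (\<Prod>e\<in>P. exp (- 2 * J e)) *
              (\<Prod>S\<in>regions G P. 2 * Z_LT G S (restrict_class G S \<epsilon>) (\<lambda>e. 2 * J e))) \<and>
         Z_dIsing G J = (\<Sum>P\<in>polygon_configs G (null_class G). W G J P) \<and>
         prob_space (P_dIsing G J) \<and>
         Mono \<in> P_dIsing G J \<rightarrow>\<^sub>M count_space (polygon_configs G (null_class G)) \<and>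
         prob_space (distr (P_dIsing G J) (count_space (polygon_configs G (null_class G))) Mono) \<and>
         (\<forall>P\<in>polygon_configs G (null_class G).
            measure (distr (P_dIsing G J) (count_space (polygon_configs G (null_class G))) Mono) {P} =
              W G J P / Z_dIsing G J \<and>
            measure (P_dIsing G J) {\<omega> \<in> space (P_dIsing G J). Mono \<omega> = P} =
              W G J P / Z_dIsing G J)"
proof -
  have "embedded_surface_graph G"
    using assms(1,2) locally_connected_closed_orientable_surface[OF assms(1)]
    by unfold_locales (auto simp: closed_orientable_surface_def cellularly_embedded_def)
  then interpret embedded_surface_graph G .
  show ?thesis
    by (intro conjI ballI W_class_eq Z_dIsing_eq_sum_W prob_space_P_dIsing measurable_Mono
        prob_space.prob_space_distr[OF prob_space_P_dIsing measurable_Mono] prob_distr_Mono prob_Mono_eq)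
qed

end
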